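(* For $d\ge3$ let $X_d=V(x^d+y^d+1)\subset\mathbb{C}^2$ be the Fermat curve. The signature curve of $X_d$ has (1) degree four for all $d\ge3$ for the $\mathcal{PGL}(3)$-action (with the pair of invariants $\mathcal{I}^{\mathcal{P}}$); (2) degree two for $d=3$ and degree three for all $d\ge4$ for the $\mathcal{A}(2)$-action (with the pair of invariants $\mathcal{I}^{\mathcal{A}}$).
   Context: Groups. $\mathcal{PGL}(3)$ acts rationally on $\mathbb{C}^2$ by $g\cdot(x,y)=(\phi_1/\phi_0,\phi_2/\phi_0)$, where $(\phi_0,\phi_1,\phi_2)^T=A_g(1,x,y)^T$ and $A_g$ is an invertible $3\times3$ complex matrix representing $g$ (up to scaling). $\mathcal{A}(2)$ is the subgroup of $g$ represented by matrices with first row $[1,0,0]$. Differential functions. Write $u_k$ for the jet coordinate $y^{(k)}$ and put $\Theta_4=3u_4u_2-5u_3^2$, $\Theta_5=9u_5u_2^2-45u_4u_3u_2+40u_3^3$, $\Theta_6=9u_6u_2^3-63u_5u_3u_2^2-45u_4^2u_2^2+255u_4u_3^2u_2-160u_3^4$, $\Theta_7=\frac92\big[18u_7u_2^4\Theta_5-189u_6^2u_2^6+126u_6u_2^4(9u_5u_3u_2+15u_4^2u_2-25u_4u_3^2)-189u_5^2u_2^4(4u_3^2+15u_2u_4)+210u_5u_3u_2^2(63u_4^2u_2^2-60u_4u_3^2u_2+32u_3^4)-525u_4u_2(9u_4^3u_2^3+15u_4^2u_3^2u_2^2-60u_4u_3^4u_2+64u_3^6)+11200u_3^8\big]$, $\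Theta_8=\frac{243}{2}u_2^4\big[2u_8u_2\Theta_5^2-8u_7\Theta_5(9u_6u_2^3-36u_5u_3u_2^2-45u_4^2u_2^2+120u_4u_3^2u_2-40u_3^4)+504u_6^3u_2^5-504u_6^2u_2^3(9u_5u_3u_2+15u_4^2u_2-25u_4u_3^2)+28u_6(432u_5^2u_3^2u_2^3+243u_5^2u_4u_2^4-1800u_5u_4u_3^3u_2^2-240u_5u_3^5u_2+540u_5u_4^2u_3u_2^3+6600u_4^2u_3^4u_2-2000u_4u_3^6-5175u_4^3u_3^2u_2^2+1350u_4^4u_2^3)-2835u_5^4u_2^4+252u_5^3u_3u_2^2(9u_4u_2-136u_3^2)-35840u_5^2u_3^6-630u_5^2u_4u_2(69u_4^2u_2^2-160u_3^4-153u_4u_3^2u_2)+2100u_5u_4^2u_3(72u_3^4+63u_4^2u_2^2-193u_4u_3^2u_2)-7875u_4^4(8u_4^2u_2^2-22u_4u_3^2u_2+9u_3^4)\big]$. Invariant pairs $\{K_1,K_2\}$: $\mathcal{I}^{\mathcal{A}}$: $K_1=\Theta_5^2/\Theta_4^3$, $K_2=\Theta_6/\Theta_4^2$; $\mathcal{I}^{\mathcal{P}}$: $K_1=\Theta_7^3/\Theta_5^8$, $K_2=\Theta_8/\Theta_5^4$. Signature. For an irreducible curve $X=V(F)$ and $p=(p_1,p_2)\in X$ with $F_y(p)\neq0$, $X$ is near $p$ the graph of an analytic function $y=f(x)$; $y^{(n)}_X(p)=f^{(n)}(p_1)$ defines a rational function on $X$, and $K|_X$ is obtained from $K$ by substituting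 $y_X^{(n)}$ for $y^{(n)}$. The signature map is $\sigma_X=(K_1|_X,K_2|_X):X\dashrightarrow\mathbb{C}^2$, and the signature curve is the Zariski closure of $\sigma_X(X)$ in $\mathbb{C}^2$ (when this has dimension 1); its degree is the degree of its irreducible defining polynomial. *)

theory Defs
  imports "HOL-Complex_Analysis.Complex_Analysis"
    "HOL-Computational_Algebra.Computational_Algebra"
begin

section \<open>Plane algebraic curves\<close>

text \<open>
  \<^typ>\<open>complex poly poly\<close> stands for the ring of polynomials in x and y over the complex
  numbers, the outer variable being y and the coefficients being polynomials in x. In particular
  \<^const>\<open>pderiv\<close> is the partial derivative with respect to y.
\<close>

type_synonym bipoly = "complex poly poly"

definition eval2 :: "bipoly \<Rightarrow> complex \<times> complex \<Rightarrow> complex" where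
  "eval2 F p = poly (poly F [:snd p:]) (fst p)"

definition total_degree :: "bipoly \<Rightarrow> nat" where
  "total_degree F = Max {i + j | i j. coeff (coeff F j) i \<noteq> 0}"

definition zero_locus :: "bipoly \<Rightarrow> (complex \<times> complex) set" where
  "zero_locus F = {p. eval2 F p = 0}"

definition zariski_closure :: "(complex \<times> complex) set \<Rightarrow> (complex \<times> complex) set" where
  "zariski_closure S = \<Inter> {zero_locus G | G. S \<subseteq> zero_locus G}"

text \<open>
  S is an irreducible curve whose irreducible defining polynomial has degree n. That
  polynomial is unique up to a constant factor, so n is determined by S.
\<close>

definition irreducible_curve_of_degree :: "(complex \<times> complex) set \<Rightarrow> nat \<Rightarrow> bool" where
  "irreducible_curve_of_degree S n \<longleftrightarrow>
     (\<exists>G. irreducible G \<and> S = zero_locus G \<and> total_degree G = n)"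

definition fermat :: "nat \<Rightarrow> bipoly" where
  "fermat d = [:monom 1 d:] + monom 1 d + 1"


section \<open>Derivatives of y along a curve\<close>

definition local_graph :: "bipoly \<Rightarrow> complex \<times> complex \<Rightarrow> (complex \<Rightarrow> complex) \<Rightarrow> bool" where
  "local_graph F p f \<longleftrightarrow>
     (\<exists>U W. open U \<and> open W \<and> fst p \<in> U \<and> snd p \<in> W \<and> f holomorphic_on U \<and> f ` U \<subseteq> W \<and>
        (\<forall>x\<in>U. \<forall>y\<in>W. (x, y) \<in> zero_locus F \<longleftrightarrow> y = f x))"

text \<open>
  The value at p of the n-th derivative of y along the curve. It is meaningful at points p of
  the curve where the partial derivative with respect to y does not vanish; there a local graph f
  exists and its germ at p is unique, so the choice of f does not matter.
\<close>

definition curve_jet :: "bipoly \<Rightarrow> complex \<times> complex \<Rightarrow> nat \<Rightarrow> complex" where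
  "curve_jet F p n = (deriv ^^ n) (SOME f. local_graph F p f) (fst p)"


section \<open>Differential functions and signatures\<close>

text \<open>
  A differential polynomial is a function of the jet u, where u k is the k-th derivative of y.
  A rational differential function is given as a pair (numerator, denominator).
\<close>

type_synonym diff_poly = "(nat \<Rightarrow> complex) \<Rightarrow> complex"
type_synonym diff_fun = "diff_poly \<times> diff_poly"

text \<open>
  The restriction of K to the curve X defined by an irreducible F is a rational function on X.
  It is regular at p with value c iff it has a representation P/Q by polynomials with Q nonzero
  at p and P/Q equal to c there. That P/Q represents the restriction means that the two
  agree on a nonempty Zariski-open subset of X, and on an irreducible curve these subsets are
  exactly the complements of finite proper subsets. If the denominator of K vanishes identically
  on X, then no point has a value.
\<close>

definition regular_value ::
    "bipoly \<Rightarrow> diff_fun \<Rightarrow> complex \<times> complex \<Rightarrow> complex \<Rightarrow> bool" where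
  "regular_value F K p c \<longleftrightarrow>
     (\<exists>P Q. eval2 Q p \<noteq> 0 \<and> c = eval2 P p / eval2 Q p \<and>
        finite {q \<in> zero_locus F. \<not> (eval2 (pderiv F) q \<noteq> 0 \<and>
          snd K (curve_jet F q) \<noteq> 0 \<and> eval2 Q q \<noteq> 0 \<and>
          fst K (curve_jet F q) / snd K (curve_jet F q) = eval2 P q / eval2 Q q)})"

text \<open>The image of the signature map, taken over all points of X where both components are regular.\<close>

definition signature_image :: "bipoly \<Rightarrow> diff_fun \<times> diff_fun \<Rightarrow> (complex \<times> complex) set" where
  "signature_image F I =
     {(a, b). \<exists>p \<in> zero_locus F. regular_value F (fst I) p a \<and> regular_value F (snd I) p b}"

definition signature_curve :: "bipoly \<Rightarrow> diff_fun \<times> diff_fun \<Rightarrow> (complex \<times> complex) set" where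
  "signature_curve F I = zariski_closure (signature_image F I)"


section \<open>The classifying invariants of the affine and the projective group\<close>

definition \<Theta>4 :: diff_poly where
  "\<Theta>4 u = 3 * u 4 * u 2 - 5 * u 3 ^ 2"

definition \<Theta>5 :: diff_poly where
  "\<Theta>5 u = 9 * u 5 * u 2 ^ 2 - 45 * u 4 * u 3 * u 2 + 40 * u 3 ^ 3"

definition \<Theta>6 :: diff_poly where
  "\<Theta>6 u = 9 * u 6 * u 2 ^ 3 - 63 * u 5 * u 3 * u 2 ^ 2 - 45 * u 4 ^ 2 * u 2 ^ 2
     + 255 * u 4 * u 3 ^ 2 * u 2 - 160 * u 3 ^ 4"

definition \<Theta>7 :: diff_poly where
  "\<Theta>7 u = 9 / 2 * (18 * u 7 * u 2 ^ 4 * \<Theta>5 u - 189 * u 6 ^ 2 * u 2 ^ 6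
     + 126 * u 6 * u 2 ^ 4 * (9 * u 5 * u 3 * u 2 + 15 * u 4 ^ 2 * u 2 - 25 * u 4 * u 3 ^ 2)
     - 189 * u 5 ^ 2 * u 2 ^ 4 * (4 * u 3 ^ 2 + 15 * u 2 * u 4)
     + 210 * u 5 * u 3 * u 2 ^ 2
         * (63 * u 4 ^ 2 * u 2 ^ 2 - 60 * u 4 * u 3 ^ 2 * u 2 + 32 * u 3 ^ 4)
     - 525 * u 4 * u 2
         * (9 * u 4 ^ 3 * u 2 ^ 3 + 15 * u 4 ^ 2 * u 3 ^ 2 * u 2 ^ 2
            - 60 * u 4 * u 3 ^ 4 * u 2 + 64 * u 3 ^ 6)
     + 11200 * u 3 ^ 8)"

definition \<Theta>8 :: diff_poly where
  "\<Theta>8 u = 243 / 2 * u 2 ^ 4 * (2 * u 8 * u 2 * \<Theta>5 u ^ 2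
     - 8 * u 7 * \<Theta>5 u
         * (9 * u 6 * u 2 ^ 3 - 36 * u 5 * u 3 * u 2 ^ 2 - 45 * u 4 ^ 2 * u 2 ^ 2
            + 120 * u 4 * u 3 ^ 2 * u 2 - 40 * u 3 ^ 4)
     + 504 * u 6 ^ 3 * u 2 ^ 5
     - 504 * u 6 ^ 2 * u 2 ^ 3
         * (9 * u 5 * u 3 * u 2 + 15 * u 4 ^ 2 * u 2 - 25 * u 4 * u 3 ^ 2)
     + 28 * u 6
         * (432 * u 5 ^ 2 * u 3 ^ 2 * u 2 ^ 3 + 243 * u 5 ^ 2 * u 4 * u 2 ^ 4
            - 1800 * u 5 * u 4 * u 3 ^ 3 * u 2 ^ 2 - 240 * u 5 * u 3 ^ 5 * u 2
            + 540 * u 5 * u 4 ^ 2 * u 3 * u 2 ^ 3 + 6600 * u 4 ^ 2 * u 3 ^ 4 * u 2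
            - 2000 * u 4 * u 3 ^ 6 - 5175 * u 4 ^ 3 * u 3 ^ 2 * u 2 ^ 2
            + 1350 * u 4 ^ 4 * u 2 ^ 3)
     - 2835 * u 5 ^ 4 * u 2 ^ 4
     + 252 * u 5 ^ 3 * u 3 * u 2 ^ 2 * (9 * u 4 * u 2 - 136 * u 3 ^ 2)
     - 35840 * u 5 ^ 2 * u 3 ^ 6
     - 630 * u 5 ^ 2 * u 4 * u 2
         * (69 * u 4 ^ 2 * u 2 ^ 2 - 160 * u 3 ^ 4 - 153 * u 4 * u 3 ^ 2 * u 2)
     + 2100 * u 5 * u 4 ^ 2 * u 3
         * (72 * u 3 ^ 4 + 63 * u 4 ^ 2 * u 2 ^ 2 - 193 * u 4 * u 3 ^ 2 * u 2)
     - 7875 * u 4 ^ 4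
         * (8 * u 4 ^ 2 * u 2 ^ 2 - 22 * u 4 * u 3 ^ 2 * u 2 + 9 * u 3 ^ 4))"

definition affine_invariants :: "diff_fun \<times> diff_fun" where
  "affine_invariants =
     ((\<lambda>u. \<Theta>5 u ^ 2, \<lambda>u. \<Theta>4 u ^ 3), (\<lambda>u. \<Theta>6 u, \<lambda>u. \<Theta>4 u ^ 2))"

definition projective_invariants :: "diff_fun \<times> diff_fun" where
  "projective_invariants =
     ((\<lambda>u. \<Theta>7 u ^ 3, \<lambda>u. \<Theta>5 u ^ 8), (\<lambda>u. \<Theta>8 u, \<lambda>u. \<Theta>5 u ^ 4))"

end

theory Submission
  imports Defs
begin

text \<open>
  On \<open>X\<^sub>d\<close> the derivative of order \<open>n\<close> is \<open>y / (x y\<^sup>d)\<^sup>n\<close> times a polynomial in \<open>x\<^sup>d\<close>, so by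
  homogeneity both invariants are rational functions of \<open>x\<^sup>d\<close>, and by symmetry rational functions of
  \<open>e = x\<^sup>d y\<^sup>d\<close>. In the affine case they are polynomials, of degrees at most 3 and 2, in
  \<open>w = 1 / ((d + 1) e - (d - 2))\<close>; in the projective case they are polynomials of degrees 4 and 2 in
  \<open>w = (1 - e)\<^sup>3 / ((1 - 4 e) (e + 2)\<^sup>2)\<close>. Thus the signature curve is a polynomially parametrised
  curve \<open>{(f w, g w)}\<close> with \<open>g\<close> quadratic (linear in the affine case with \<open>d = 5\<close>). Completing the
  square in \<open>g\<close> one eliminates \<open>w\<close> by hand and reads off the degree. Only for \<open>d = 3\<close> does the
  leading coefficient of \<open>f\<close> vanish in the affine case.

  The equation obtained is quadratic in the first coordinate with constant leading coefficient and has
  two distinct roots for almost every value of the second one. It is therefore irreducible: one of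
  two factors vanishes on the whole curve, hence has full degree in the first coordinate, and the other
  is a polynomial in the second coordinate without zeros.
\<close>

section \<open>Polynomially parametrised plane curves\<close>

lemma eval2_pCons: "eval2 (pCons c P) (a, b) = poly c a + b * eval2 P (a, b)"
  by (simp add: eval2_def)

lemma eval2_mult: "eval2 (P * Q) p = eval2 P p * eval2 Q p"
  by (simp add: eval2_def)

text \<open>Pulling back along the parametrisation reduces vanishing on the curve to the zeros of
  one polynomial in \<open>w\<close>; Horner's scheme in the outer variable builds it.\<close>

lemma eval2_parametrized: "\<exists>r. \<forall>w. poly r w = eval2 P (poly f w, poly g w)"
proof (induction P)
  case 0
  show ?case by (rule exI[of _ 0]) (simp add: eval2_def)
next
  case (pCons c P)
  then obtain r where r: "\<forall>w. poly r w = eval2 P (poly f w, poly g w)" by blast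
  show ?case
    by (rule exI[of _ "pcompose c f + g * r"]) (simp add: eval2_pCons r poly_pcompose)
qed

text \<open>A polynomial vanishing on \<open>S\<close> pulls back to a polynomial in
  \<open>w\<close> with infinitely many zeros, hence to 0, so it vanishes on the whole parametrised
  curve.\<close>

lemma zariski_closure_parametrized:
  assumes V: "zero_locus G = range (\<lambda>w. (poly f w, poly g w))"
    and sub: "S \<subseteq> zero_locus G"
    and inf: "infinite {w. (poly f w, poly g w) \<in> S}"
  shows "zariski_closure S = zero_locus G"
proof -
  have "zero_locus G \<subseteq> zero_locus H" if "S \<subseteq> zero_locus H" for H
  proof -
    obtain r where r: "\<forall>w. poly r w = eval2 H (poly f w, poly g w)"
      using eval2_parametrized by blast
    have "{w. (poly f w, poly g w) \<in> S} \<subseteq> {w. poly r w = 0}"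
      using that by (auto simp: r zero_locus_def)
    hence "infinite {w. poly r w = 0}" using inf finite_subset by blast
    hence "r = 0" using poly_roots_finite by blast
    hence "eval2 H (poly f w, poly g w) = 0" for w using r[rule_format, of w] by simp
    thus ?thesis by (auto simp: V) (simp add: zero_locus_def)
  qed
  thus ?thesis using sub unfolding zariski_closure_def by blast
qed

text \<open>Each coefficient of the slice at height \<open>b\<close> is a polynomial in
  \<open>b\<close>, so it is zero once it vanishes for infinitely many \<open>b\<close>.\<close>

lemma coeff_poly_const: "coeff (poly Q [:b:]) k = poly (map_poly (\<lambda>c. coeff c k) Q) b"
  by (induction Q) (simp_all add: map_poly_pCons)

text \<open>\<open>poly G [:b:]\<close> is the restriction of \<open>G\<close> to the horizontal
  line at height \<open>b\<close>. Its degree is \<open>n\<close> for every \<open>b\<close>, not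
  just for most, so no slice vanishes identically; this excludes nonconstant factors in the second
  coordinate alone.\<close>

lemma irreducible_if_parametrized:
  assumes V: "zero_locus G = range (\<lambda>w. (poly f w, poly g w))"
    and deg: "\<And>b. degree (poly G [:b:]) = n" and n: "n > 0"
    and inf: "infinite {b. card {a. poly (poly G [:b:]) a = 0} = n}"
  shows "irreducible G"
proof -
  let ?B = "{b. card {a. poly (poly G [:b:]) a = 0} = n}"
  have nz: "poly G [:b:] \<noteq> 0" for b using deg[of b] n by auto
  have unit: "Q dvd 1" if PQ: "G = P * Q" and van: "zero_locus G \<subseteq> zero_locus P" for P Q
  proof -
    have PQb: "poly G [:b:] = poly P [:b:] * poly Q [:b:]" for b by (simp add: PQ)
    have nzb: "poly P [:b:] \<noteq> 0" "poly Q [:b:] \<noteq> 0" for b using nz[of b] PQb[of b] by auto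
    \<comment> \<open>\<open>P\<close> has all \<open>n\<close> roots of the slice, so it uses up
      the whole degree and leaves none for \<open>Q\<close>.\<close>
    have degQ: "degree (poly Q [:b:]) = 0" if b: "b \<in> ?B" for b
    proof -
      have "{a. poly (poly G [:b:]) a = 0} \<subseteq> {a. poly (poly P [:b:]) a = 0}"
        using van by (auto simp: zero_locus_def eval2_def subset_iff)
      hence "n \<le> card {a. poly (poly P [:b:]) a = 0}"
        using b card_mono[OF poly_roots_finite[OF nzb(1)]] by fastforce
      also have "\<dots> \<le> degree (poly P [:b:])" by (rule card_poly_roots_bound[OF nzb(1)])
      finally have "n \<le> degree (poly P [:b:])" .
      moreover have "degree (poly P [:b:]) + degree (poly Q [:b:]) = n"
        using deg[of b] degree_mult_eq[OF nzb] PQb by simp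
      ultimately show ?thesis by simp
    qed
    have zero: "map_poly (\<lambda>c. coeff c k) Q = 0" if "k > 0" for k
    proof -
      have "?B \<subseteq> {b. poly (map_poly (\<lambda>c. coeff c k) Q) b = 0}"
        unfolding coeff_poly_const[symmetric] using degQ that by (auto intro: coeff_eq_0)
      thus ?thesis using inf poly_roots_finite finite_subset by blast
    qed
    have const: "coeff (coeff Q j) k = 0" if "k > 0" for j k
      using zero[OF that] coeff_map_poly[of "\<lambda>c. coeff c k" Q j] by simp
    define q where "q = map_poly (\<lambda>c. coeff c 0) Q"
    have "poly Q [:b:] = [:poly q b:]" for b
    proof (rule poly_eqI)
      fix k show "coeff (poly Q [:b:]) k = coeff [:poly q b:] k"
        by (cases "k = 0") (auto simp: coeff_poly_const q_def zero coeff_pCons split: nat.split)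
    qed
    \<comment> \<open>A root of \<open>q\<close> would make an entire slice of \<open>G\<close>
      vanish.\<close>
    hence "\<not> (\<exists>b. poly q b = 0)" using nzb(2) by (metis pCons_0_0)
    hence "degree q = 0" using fundamental_theorem_of_algebra_alt constant_degree
      by (metis fundamental_theorem_of_algebra)
    hence q0: "coeff q j = 0" if "j > 0" for j using that by (simp add: coeff_eq_0)
    have Q: "Q = [:[:coeff q 0:]:]"
    proof (rule poly_eqI, rule poly_eqI)
      fix j k show "coeff (coeff Q j) k = coeff (coeff [:[:coeff q 0:]:] j) k"
        using q0[of j] const[of k j] coeff_map_poly[of "\<lambda>c. coeff c 0" Q j]
        by (cases "k = 0"; cases "j = 0") (auto simp: q_def coeff_pCons split: nat.split)
    qed
    have "coeff q 0 \<noteq> 0" using nzb(2)[of 0] Q by auto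
    thus ?thesis by (subst Q) (simp add: is_unit_const_poly_iff dvd_field_iff)
  qed
  show ?thesis
  proof (rule irreducibleI)
    show "G \<noteq> 0" using nz by auto
    show "\<not> G dvd 1"
    proof
      assume "G dvd 1"
      then obtain H where "1 = G * H" by (auto simp: dvd_def)
      hence "poly G [:0:] * poly H [:0:] = 1" by (metis poly_mult poly_1)
      hence "poly G [:0:] dvd 1" by (metis dvd_triv_left)
      hence "degree (poly G [:0:]) = 0" using is_unit_iff_degree[OF nz] by blast
      thus False using deg[of 0] n by simp
    qed
    fix P Q assume PQ: "G = P * Q"
    obtain p q where p: "\<forall>w. poly p w = eval2 P (poly f w, poly g w)"
      and q: "\<forall>w. poly q w = eval2 Q (poly f w, poly g w)"
      using eval2_parametrized by metis
    \<comment> \<open>The pullback of \<open>P * Q\<close> is zero, so one of the two factors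
      already has zero pullback.\<close>
    have "poly (p * q) w = 0" for w
    proof -
      have "(poly f w, poly g w) \<in> zero_locus G" using V by auto
      thus ?thesis by (simp add: p q zero_locus_def PQ eval2_mult)
    qed
    hence "p * q = 0" using poly_all_0_iff_0 by blast
    hence "p = 0 \<or> q = 0" by simp
    thus "P dvd 1 \<or> Q dvd 1"
    proof
      assume "p = 0"
      hence "zero_locus G \<subseteq> zero_locus P" using p by (auto simp: V) (simp add: zero_locus_def)
      thus ?thesis using unit PQ by blast
    next
      assume "q = 0"
      hence "zero_locus G \<subseteq> zero_locus Q" using q by (auto simp: V) (simp add: zero_locus_def)
      thus ?thesis using unit[of Q P] PQ by (simp add: mult.commute)
    qed
  qed
qed

section \<open>Explicit equations and total degrees of the parametrised curves\<close>

lemma total_degree_eqI: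
  assumes "\<And>i j. coeff (coeff G j) i \<noteq> 0 \<Longrightarrow> i + j \<le> n"
    and "coeff (coeff G l) k \<noteq> 0" "k + l = n"
  shows "total_degree G = n"
  unfolding total_degree_def
proof (rule Max_eqI)
  show "finite {i + j |i j. coeff (coeff G j) i \<noteq> 0}"
    by (rule finite_subset[of _ "{..n}"]) (auto dest: assms(1))
qed (use assms in auto)

abbreviation in_y :: "complex poly \<Rightarrow> bipoly" where
  "in_y p \<equiv> map_poly (\<lambda>c. [:c:]) p"

lemma poly_in_y: "poly (in_y p) [:b:] = [:poly p b:]"
  by (induction p) (simp_all add: map_poly_pCons)

text \<open>The linear \<open>g\<close> has the inverse \<open>s\<close>, so the curve is the graph
  of \<open>pcompose f s\<close> over the second coordinate. This serves the affine case
  \<open>d = 5\<close>.\<close>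

lemma irreducible_graph_curve:
  assumes g: "\<And>w. poly g w = b0 + b1 * w" and b1: "b1 \<noteq> 0" and deg: "degree f > 0"
  shows "\<exists>G. irreducible G \<and> zero_locus G = range (\<lambda>w. (poly f w, poly g w)) \<and> total_degree G = degree f"
proof -
  define s where "s = [:- b0 / b1, 1 / b1:]"
  define h where "h = pcompose f s"
  define G where "G = [:[:0, 1:]:] - in_y h"
  have sg: "poly s (poly g w) = w" and gs: "poly g (poly s b) = b" for b w
    using b1 by (simp_all add: s_def g field_simps)
  have "degree s = 1" using b1 by (simp add: s_def)
  hence dh: "degree h = degree f" by (simp add: h_def degree_pcompose)
  have Gb: "poly G [:b:] = [:- poly h b, 1:]" for b by (simp add: G_def poly_in_y)
  have V: "zero_locus G = range (\<lambda>w. (poly f w, poly g w))"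
  proof -
    have "(a, b) \<in> zero_locus G \<longleftrightarrow> a = poly f (poly s b)" for a b
      by (simp add: zero_locus_def eval2_def Gb h_def poly_pcompose)
    moreover have "a = poly f (poly s b) \<longleftrightarrow> (a, b) \<in> range (\<lambda>w. (poly f w, poly g w))" for a b
      using gs[of b] by (auto simp: sg intro: sym rangeI)
    ultimately show ?thesis by auto
  qed
  have "{a. poly (poly G [:b:]) a = 0} = {poly h b}" for b by (auto simp: Gb)
  hence "irreducible G"
    by (intro irreducible_if_parametrized[OF V, of 1]) (auto simp: Gb infinite_UNIV_char_0)
  moreover have "total_degree G = degree f"
  proof (rule total_degree_eqI[where k = 0 and l = "degree f"])
    have c: "coeff G j = (if j = 0 then [:0, 1:] else 0) - [:coeff h j:]" for j
      by (simp add: G_def coeff_map_poly coeff_pCons split: nat.split)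
    show "i + j \<le> degree f" if "coeff (coeff G j) i \<noteq> 0" for i j
      using that deg c[of j] le_degree[of h j] dh
      by (cases i; cases "j = 0"; cases "i = 1") (auto simp: coeff_pCons split: nat.splits)
    have "h \<noteq> 0" using deg dh by auto
    thus "coeff (coeff G (degree f)) 0 \<noteq> 0" using deg c[of "degree f"] dh leading_coeff_0_iff[of h] by auto
  qed simp
  ultimately show ?thesis using V by blast
qed

text \<open>Eliminating \<open>w - w0\<close> from \<open>a = E(s) + (w - w0) O(s)\<close> and \<open>s = (w - w0)\<^sup>2\<close>, where \<open>E\<close> and \<open>O\<close>
  collect the even and odd coefficients of \<open>f\<close>, gives \<open>(a - E(s))\<^sup>2 = s O(s)\<^sup>2\<close>.\<close>

lemma irreducible_quadratic_curve:
  assumes f: "\<And>w. poly f w = f0 + f1 * (w - w0) + f2 * (w - w0) ^ 2 + f3 * (w - w0) ^ 3 + f4 * (w - w0) ^ 4"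
    and g: "\<And>w. poly g w = b0 + b2 * (w - w0) ^ 2" and b2: "b2 \<noteq> 0"
    and odd: "f1 \<noteq> 0 \<or> f3 \<noteq> 0"
    and n: "n = 4 \<and> f4 \<noteq> 0 \<or> n = 3 \<and> f4 = 0 \<and> f3 \<noteq> 0 \<or> n = 2 \<and> f4 = 0 \<and> f3 = 0"
  shows "\<exists>G. irreducible G \<and> zero_locus G = range (\<lambda>w. (poly f w, poly g w)) \<and> total_degree G = n"
proof -
  \<comment> \<open>\<open>s\<close> recovers \<open>(w - w0) ^ 2\<close> from the second
    coordinate.\<close>
  define s where "s = [:- b0 / b2, 1 / b2:]"
  define E where "E = [:f0, f2, f4:]"
  define U where "U = [:f1, f3:]"
  define R where "R = pcompose (E ^ 2 - [:0, 1:] * U ^ 2) s"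
  define E' where "E' = pcompose E s"
  \<comment> \<open>The quadratic \<open>(a - E) ^ 2 - s * U ^ 2\<close> in \<open>a\<close>,
    expanded; \<open>R\<close> is its constant term.\<close>
  define G where "G = in_y R - smult [:0, 2:] (in_y E') + [:[:0, 0, 1:]:]"
  have s: "poly s b = (w - w0) ^ 2 \<longleftrightarrow> b = poly g w" for b w
    using b2 by (auto simp: s_def g field_simps)
  have ds: "degree s = 1" using b2 by (simp add: s_def)
  have f': "poly f w = poly E ((w - w0) ^ 2) + (w - w0) * poly U ((w - w0) ^ 2)" for w
    unfolding f E_def U_def by (simp; algebra)
  have Gb: "poly G [:b:] = [:poly R b, - 2 * poly E' b, 1:]" for b by (simp add: G_def poly_in_y)
  \<comment> \<open>A square root \<open>h\<close> of \<open>s\<close> at \<open>b\<close> plays the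
    role of \<open>w - w0\<close>; the two roots belong to the parameters \<open>w0 + h\<close> and
    \<open>w0 - h\<close>.\<close>
  have root: "poly (poly G [:b:]) a = 0 \<longleftrightarrow> a = poly E (h ^ 2) + h * poly U (h ^ 2) \<or> a = poly E (h ^ 2) - h * poly U (h ^ 2)"
    if h: "h ^ 2 = poly s b" for a b h
  proof -
    have "poly (poly G [:b:]) a = (a - (poly E (h ^ 2) + h * poly U (h ^ 2))) * (a - (poly E (h ^ 2) - h * poly U (h ^ 2)))"
      unfolding Gb R_def E'_def poly_pcompose h[symmetric] by (simp; algebra)
    thus ?thesis by auto
  qed
  have V: "zero_locus G = range (\<lambda>w. (poly f w, poly g w))"
  proof (intro equalityI subsetI)
    fix p assume p: "p \<in> zero_locus G"
    obtain a b where ab: "p = (a, b)" by (cases p)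
    define h where "h = csqrt (poly s b)"
    have h: "h ^ 2 = poly s b" by (simp add: h_def)
    have "poly (poly G [:b:]) a = 0" using p ab by (simp add: zero_locus_def eval2_def)
    then consider "a = poly f (w0 + h)" | "a = poly f (w0 - h)"
      using root[OF h] f'[of "w0 + h"] f'[of "w0 - h"] by auto
    moreover have "b = poly g (w0 + h)" "b = poly g (w0 - h)"
      using s[of b "w0 + h"] s[of b "w0 - h"] h by auto
    ultimately show "p \<in> range (\<lambda>w. (poly f w, poly g w))" using ab by cases auto
  next
    fix p assume "p \<in> range (\<lambda>w. (poly f w, poly g w))"
    then obtain w where p: "p = (poly f w, poly g w)" by auto
    have "(w - w0) ^ 2 = poly s (poly g w)" using s by metis
    from root[OF this, of "poly f w"] show "p \<in> zero_locus G"
      by (simp add: p zero_locus_def eval2_def f')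
  qed
  have irr: "irreducible G"
  proof (rule irreducible_if_parametrized[OF V, of 2])
    \<comment> \<open>The two roots differ by \<open>2 * h * U (h ^ 2)\<close>, which is nonzero off
      \<open>?Z\<close>; by \<open>odd\<close> the polynomial defining \<open>?Z\<close> is not
      zero.\<close>
    let ?Z = "{b. poly (pcompose ([:0, 1:] * U) s) b = 0}"
    have "U \<noteq> 0" using odd by (auto simp: U_def)
    hence "pcompose ([:0, 1:] * U) s \<noteq> 0" using ds by (subst pcompose_eq_0_iff) auto
    hence fin: "finite ?Z" by (rule poly_roots_finite)
    have "- ?Z \<subseteq> {b. card {a. poly (poly G [:b:]) a = 0} = 2}"
    proof
      fix b assume "b \<in> - ?Z"
      hence b: "poly s b \<noteq> 0" "poly U (poly s b) \<noteq> 0" by (auto simp: poly_pcompose)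
      define h where "h = csqrt (poly s b)"
      have h: "h ^ 2 = poly s b" by (simp add: h_def)
      have "h * poly U (h ^ 2) \<noteq> 0" using b h by auto
      hence "poly E (h ^ 2) + h * poly U (h ^ 2) \<noteq> poly E (h ^ 2) - h * poly U (h ^ 2)"
        by (simp add: eq_diff_eq add_eq_0_iff)
      moreover have "{a. poly (poly G [:b:]) a = 0}
          = {poly E (h ^ 2) + h * poly U (h ^ 2), poly E (h ^ 2) - h * poly U (h ^ 2)}"
        using root[OF h] by auto
      ultimately show "b \<in> {b. card {a. poly (poly G [:b:]) a = 0} = 2}" by simp
    qed
    thus "infinite {b. card {a. poly (poly G [:b:]) a = 0} = 2}"
      using fin infinite_UNIV_char_0 by (metis Compl_eq_Diff_UNIV finite_Diff2 finite_subset)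
  qed (simp_all add: Gb)
  have c: "coeff G j = [:coeff R j, - 2 * coeff E' j, if j = 0 then 1 else 0:]" for j
    by (simp add: G_def coeff_map_poly coeff_pCons split: nat.split)
  \<comment> \<open>The degree is read off here: the top coefficient is \<open>f4 ^ 2\<close>, or
    \<open>- f3 ^ 2\<close> if \<open>f4 = 0\<close>. If both vanish, \<open>R\<close> may have
    degree below 2, and the monomial \<open>a ^ 2\<close> of \<open>G\<close> attains the total
    degree.\<close>
  have R: "E ^ 2 - [:0, 1:] * U ^ 2
      = [:f0 ^ 2, 2 * f0 * f2 - f1 ^ 2, f2 ^ 2 + 2 * f0 * f4 - 2 * f1 * f3, 2 * f2 * f4 - f3 ^ 2, f4 ^ 2:]"
    by (simp add: E_def U_def power2_eq_square algebra_simps)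
  have dR: "degree R = degree (E ^ 2 - [:0, 1:] * U ^ 2)" and dE: "degree E' = degree E"
    by (simp_all add: R_def E'_def degree_pcompose ds)
  have le: "degree R \<le> n" "degree E' + 1 \<le> n" "2 \<le> n"
    using n unfolding dR dE R by (auto simp: E_def)
  have top: "n \<noteq> 2 \<Longrightarrow> degree R = n" using n unfolding dR R by auto
  have bound: "i + j \<le> n" if "coeff (coeff G j) i \<noteq> 0" for i j
  proof -
    consider "i = 0" | "i = 1" | "i = 2" | "i > 2" by linarith
    thus ?thesis
    proof cases
      case 1
      thus ?thesis using that le le_degree[of R j] by (simp add: c)
    next
      case 2
      thus ?thesis using that le le_degree[of E' j] by (simp add: c)
    next
      case 3
      thus ?thesis using that le by (simp add: c numeral_2_eq_2 split: if_splits)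
    next
      case 4
      hence "coeff (coeff G j) i = 0" by (simp add: c coeff_eq_0)
      thus ?thesis using that by simp
    qed
  qed
  have "total_degree G = n"
  proof (cases "n = 2")
    case True
    thus ?thesis
      by (intro total_degree_eqI[where k = 2 and l = 0, OF bound]) (simp_all add: c numeral_2_eq_2)
  next
    case False
    hence "coeff R n \<noteq> 0" using top le(3) by (metis leading_coeff_0_iff degree_0 not_numeral_le_zero)
    thus ?thesis by (intro total_degree_eqI[where k = 0 and l = n, OF bound]) (simp_all add: c)
  qed
  thus ?thesis using irr V by blast
qed


section \<open>Derivatives along the Fermat curve\<close>

text \<open>The recursion is the derivative of \<open>y / (x * Y) ^ n * J X\<close> with
  \<open>X = x ^ d\<close> and \<open>Y = - 1 - X\<close>; the factor \<open>[:0, -1, -1:]\<close>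
  is \<open>X * Y\<close>. A complex \<open>c\<close> in place of \<open>d\<close> allows one
  computation for all exponents.\<close>

primrec fermat_jet :: "complex \<Rightarrow> nat \<Rightarrow> complex poly" where
  "fermat_jet c 0 = 1"
| "fermat_jet c (Suc n) = smult c ([:0, -1, -1:] * pderiv (fermat_jet c n))
     + [:of_nat n, of_nat n * (c + 1) - 1:] * fermat_jet c n"

lemma eval2_fermat: "eval2 (fermat d) (x, y) = x ^ d + y ^ d + 1"
  by (simp add: eval2_def fermat_def poly_monom poly_power)

lemma eval2_pderiv_fermat: "eval2 (pderiv (fermat d)) (x, y) = of_nat d * y ^ (d - 1)"
proof -
  have "poly (of_nat d :: complex poly) x = of_nat d" by (simp add: of_nat_poly)
  thus ?thesis
    by (simp add: eval2_def fermat_def pderiv_add pderiv_monom poly_monom poly_power pderiv_pCons)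
qed

section \<open>Analytic branches of the curve and their derivatives\<close>

lemma in_fermat_iff: "(x, y) \<in> zero_locus (fermat d) \<longleftrightarrow> y ^ d = - 1 - x ^ d"
  by (auto simp: zero_locus_def eval2_fermat algebra_simps eq_neg_iff_add_eq_0)

text \<open>The target neighbourhood is taken to be the image of the branch, which is open because the
  branch is injective; uniqueness of the root in it is then automatic.\<close>

lemma holomorphic_root_branch:
  fixes c :: complex
  assumes "c \<noteq> 0" "d > 0"
  obtains U r where "open U" "c ^ d \<in> U" "r holomorphic_on U" "open (r ` U)" "r (c ^ d) = c"
    "\<And>z. z \<in> U \<Longrightarrow> r z ^ d = z"
proof
  \<comment> \<open>Dividing by \<open>c ^ d\<close> moves the base point to 1, away from the cut of
    \<open>Ln\<close>.\<close>
  let ?U = "(\<lambda>z. z / c ^ d) -` (- \<real>\<^sub>\<le>\<^sub>0)"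
  let ?r = "\<lambda>z. c * exp (Ln (z / c ^ d) / of_nat d)"
  show U: "open ?U" using assms by (intro open_vimage continuous_intros) auto
  show "c ^ d \<in> ?U" using assms by simp
  show r: "?r holomorphic_on ?U" using assms by (intro holomorphic_intros) auto
  show pow: "?r z ^ d = z" if "z \<in> ?U" for z
  proof -
    have "z / c ^ d \<noteq> 0" using that assms by auto
    thus ?thesis using assms by (simp add: power_mult_distrib exp_of_nat_mult[symmetric])
  qed
  have "inj_on ?r ?U" by (rule inj_on_inverseI[of _ "\<lambda>w. w ^ d"]) (rule pow)
  thus "open (?r ` ?U)" using open_mapping_thm3[OF r U] by blast
  show "?r (c ^ d) = c" using assms by simp
qed

text \<open>A branch of the root composed with \<open>- 1 - x ^ d\<close> is a local graph.
  Existence gives meaning to the choice made in \<open>curve_jet\<close>.\<close>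

lemma local_graph_fermat_exists:
  assumes p: "p \<in> zero_locus (fermat d)" and y: "snd p \<noteq> 0" and d: "d > 0"
  shows "\<exists>f. local_graph (fermat d) p f"
proof -
  obtain U r where r: "open U" "snd p ^ d \<in> U" "r holomorphic_on U" "open (r ` U)"
    "r (snd p ^ d) = snd p" "\<And>z. z \<in> U \<Longrightarrow> r z ^ d = z"
    by (rule holomorphic_root_branch[OF y d]) blast
  define h :: "complex \<Rightarrow> complex" where "h = (\<lambda>x. - 1 - x ^ d)"
  have hol: "h holomorphic_on A" for A unfolding h_def by (intro holomorphic_intros)
  have hp: "h (fst p) = snd p ^ d" using p by (cases p) (simp add: in_fermat_iff h_def)
  have "open (h -` U)" using r(1) unfolding h_def by (intro open_vimage continuous_intros)
  moreover have "(r \<circ> h) holomorphic_on (h -` U)"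
    by (rule holomorphic_on_compose_gen[OF hol r(3)]) auto
  moreover have "(x, y) \<in> zero_locus (fermat d) \<longleftrightarrow> y = (r \<circ> h) x" if "x \<in> h -` U" "y \<in> r ` U" for x y
    using that r(6) by (auto simp: in_fermat_iff h_def)
  moreover have "fst p \<in> h -` U" using hp r(2) by simp
  moreover have "snd p \<in> r ` U" using r(2,5) by (metis image_eqI)
  ultimately show ?thesis using r(4) unfolding local_graph_def
    by (intro exI[of _ "r \<circ> h"] exI[of _ "h -` U"] exI[of _ "r ` U"]) auto
qed

text \<open>Implicit differentiation of the equation determines the first derivative of
  \<open>f\<close>; each further one adds a factor \<open>1 / (x * Y)\<close> and a polynomial in
  \<open>X\<close>. Only the equation is used, so any local graph will do.\<close>

lemma higher_deriv_fermat:
  assumes U: "open U" and f: "f holomorphic_on U" and d: "d > 0"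
    and eq: "\<And>x. x \<in> U \<Longrightarrow> f x ^ d = - 1 - x ^ d" and nz: "\<And>x. x \<in> U \<Longrightarrow> x \<noteq> 0 \<and> f x \<noteq> 0"
    and x: "x \<in> U"
  shows "(deriv ^^ n) f x = f x / (x * (- 1 - x ^ d)) ^ n * poly (fermat_jet (of_nat d) n) (x ^ d)"
  using x
proof (induction n arbitrary: x)
  case 0
  show ?case by simp
next
  case (Suc n)
  let ?J = "\<lambda>n. fermat_jet (of_nat d) n"
  define X where "X = x ^ d"
  define Y where "Y = - 1 - X"
  have x0: "x \<noteq> 0" "f x \<noteq> 0" using nz Suc.prems by auto
  have fY: "f x ^ d = Y" using eq Suc.prems by (simp add: Y_def X_def)
  hence Y0: "Y \<noteq> 0" using x0 by auto
  have xd: "x ^ (d - 1) = X / x" using d x0 by (simp add: X_def power_diff)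
  have fd: "f x ^ (d - 1) = Y / f x" using d x0 fY by (simp add: power_diff)
  have f': "(f has_field_derivative deriv f x) (at x)"
    using holomorphic_derivI[OF f U Suc.prems] .
  have "((\<lambda>x. f x ^ d) has_field_derivative of_nat d * f x ^ (d - 1) * deriv f x) (at x)"
    by (auto intro!: derivative_eq_intros f' simp: algebra_simps)
  moreover have "((\<lambda>x. f x ^ d) has_field_derivative - (of_nat d * x ^ (d - 1))) (at x)"
    by (rule has_field_derivative_transform_within_open[OF _ U Suc.prems, of "\<lambda>x. - 1 - x ^ d"])
      (auto intro!: derivative_eq_intros simp: eq)
  ultimately have "of_nat d * f x ^ (d - 1) * deriv f x = - (of_nat d * x ^ (d - 1))"
    by (rule DERIV_unique)
  hence "of_nat d * (deriv f x * (x * Y)) = of_nat d * (- X * f x)"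
    using x0 Y0 unfolding xd fd by (simp add: field_simps)
  hence "deriv f x * (x * Y) = - X * f x" using d by (metis mult_left_cancel of_nat_0_eq_iff less_irrefl)
  hence df: "deriv f x = - X * f x / (x * Y)" using x0 Y0 by (simp add: field_simps)
  let ?r = "\<lambda>x. f x / (x * (- 1 - x ^ d)) ^ n * poly (?J n) (x ^ d)"
  have dxY: "((\<lambda>x. x * (- 1 - x ^ d)) has_field_derivative Y - of_nat d * X) (at x)"
    using power_minus_mult[OF d, of x] by (auto intro!: derivative_eq_intros simp: X_def Y_def mult_ac)
  have dp: "((\<lambda>x. poly (?J n) (x ^ d)) has_field_derivative poly (pderiv (?J n)) X * (of_nat d * X / x)) (at x)"
    unfolding X_def
    by (rule DERIV_chain2[OF poly_DERIV]) (use xd in \<open>auto intro!: derivative_eq_intros simp: X_def\<close>)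
  \<comment> \<open>Dividing by \<open>x * Y\<close> instead of lowering the exponent covers
    \<open>n = 0\<close> as well.\<close>
  have dpow: "((\<lambda>x. (x * (- 1 - x ^ d)) ^ n) has_field_derivative
      of_nat n * (x * Y) ^ n / (x * Y) * (Y - of_nat d * X)) (at x)"
  proof -
    have "of_nat n * (x * Y) ^ n / (x * Y) = of_nat n * (x * (- 1 - x ^ d)) ^ (n - Suc 0)"
      using x0 Y0 by (cases n) (simp_all add: X_def Y_def)
    thus ?thesis using DERIV_power[OF dxY, of n] by (simp add: mult_ac)
  qed
  have "(?r has_field_derivative f x / (x * Y) ^ Suc n * poly (?J (Suc n)) X) (at x)"
  proof -
    have "(?r has_field_derivative ((deriv f x * (x * Y) ^ n - f x * (of_nat n * (x * Y) ^ n / (x * Y) * (Y - of_nat d * X)))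
        / ((x * Y) ^ n * (x * Y) ^ n)) * poly (?J n) X
        + poly (pderiv (?J n)) X * (of_nat d * X / x) * (f x / (x * Y) ^ n)) (at x)"
      using DERIV_mult[OF DERIV_divide[OF f' dpow] dp] x0 Y0 unfolding X_def[symmetric] Y_def[symmetric] by simp
    moreover have "((deriv f x * (x * Y) ^ n - f x * (of_nat n * (x * Y) ^ n / (x * Y) * (Y - of_nat d * X)))
        / ((x * Y) ^ n * (x * Y) ^ n)) * poly (?J n) X
        + poly (pderiv (?J n)) X * (of_nat d * X / x) * (f x / (x * Y) ^ n)
        = f x / (x * Y) ^ Suc n * poly (?J (Suc n)) X"
    proof -
      have J: "poly (?J (Suc n)) X = of_nat d * X * Y * poly (pderiv (?J n)) X - X * poly (?J n) X
          - of_nat n * (Y - of_nat d * X) * poly (?J n) X"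
        unfolding fermat_jet.simps Y_def by (simp; algebra)
      define M where "M = (x * Y) ^ n"
      have M: "M \<noteq> 0" "(x * Y) ^ Suc n = x * Y * M" using x0 Y0 by (auto simp: M_def)
      show ?thesis unfolding df J M(2) M_def[symmetric] using x0 Y0 M(1) by (simp add: field_simps)
    qed
    ultimately show ?thesis by simp
  qed
  hence "((deriv ^^ n) f has_field_derivative f x / (x * Y) ^ Suc n * poly (?J (Suc n)) X) (at x)"
    by (rule has_field_derivative_transform_within_open[OF _ U Suc.prems]) (simp add: Suc.IH)
  hence "deriv ((deriv ^^ n) f) x = f x / (x * Y) ^ Suc n * poly (?J (Suc n)) X" by (rule DERIV_imp_deriv)
  thus ?case by (simp add: X_def Y_def)
qed

lemma curve_jet_fermat:
  assumes p: "(x, y) \<in> zero_locus (fermat d)" and nz: "x \<noteq> 0" "y \<noteq> 0" and d: "d > 0"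
  shows "curve_jet (fermat d) (x, y) n
    = y / (x * (- 1 - x ^ d)) ^ n * poly (fermat_jet (of_nat d) n) (x ^ d)"
proof -
  define f where "f = (SOME f. local_graph (fermat d) (x, y) f)"
  have "local_graph (fermat d) (x, y) f"
    unfolding f_def by (rule someI_ex[OF local_graph_fermat_exists]) (use assms in auto)
  then obtain U W where U: "open U" "x \<in> U" "y \<in> W" "f holomorphic_on U" "f ` U \<subseteq> W"
      "\<forall>x\<in>U. \<forall>y\<in>W. (x, y) \<in> zero_locus (fermat d) \<longleftrightarrow> y = f x"
    unfolding local_graph_def by auto
  have fx: "f x = y" using U p by auto
  \<comment> \<open>The chosen graph is restricted to where both coordinates are nonzero, as
    \<open>higher_deriv_fermat\<close> requires.\<close>
  define V where "V = U \<inter> f -` (- {0}) \<inter> - {0}"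
  have "open (U \<inter> f -` (- {0}))"
    by (rule continuous_open_preimage[OF holomorphic_on_imp_continuous_on[OF U(4)] U(1)]) auto
  from open_Int[OF this, of "- {0}"] have "open V" unfolding V_def by auto
  moreover have "f holomorphic_on V" using U(4) by (rule holomorphic_on_subset) (auto simp: V_def)
  moreover have "f z ^ d = - 1 - z ^ d" if "z \<in> V" for z
    using that U(5,6) by (auto simp: V_def in_fermat_iff[symmetric])
  moreover have "x \<in> V" using U(2) nz fx by (auto simp: V_def)
  ultimately have "(deriv ^^ n) f x = f x / (x * (- 1 - x ^ d)) ^ n * poly (fermat_jet (of_nat d) n) (x ^ d)"
    by (intro higher_deriv_fermat[where U = V] d) (auto simp: V_def)
  thus ?thesis by (simp add: curve_jet_def f_def[symmetric] fx)
qed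


section \<open>Jet polynomials of orders two to eight\<close>

lemma fermat_jet_2: "fermat_jet c 2 = smult (c - 1) [:0, 1:]"
  by (simp add: numeral_2_eq_2 pderiv_pCons algebra_simps)
text \<open>Each expansion takes one recursion step from the previous one. The factor
  \<open>c - 1\<close> and the zero constant term persist; dividing by \<open>(c - 1) * X\<close>
  later makes the second derivative 1.\<close>

lemma fermat_jet_3: "fermat_jet c 3 = smult (c - 1) [:0, - c + 2, c + 1:]"
proof -
  have eq: "fermat_jet c 3 = fermat_jet c (Suc 2)" by simp
  show ?thesis
    unfolding eq fermat_jet.simps(2) fermat_jet_2
    by (simp add: pderiv_pCons pderiv_smult del: One_nat_def; (intro conjI)?; algebra)
qed
lemma fermat_jet_4: "fermat_jet c 4 = smult (c - 1) [:0, c ^ 2 - 5 * c + 6, - 4 * c ^ 2 + 3 * c + 7,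
    c ^ 2 + 3 * c + 2:]"
proof -
  have eq: "fermat_jet c 4 = fermat_jet c (Suc 3)" by simp
  show ?thesis
    unfolding eq fermat_jet.simps(2) fermat_jet_3
    by (simp add: pderiv_pCons pderiv_smult del: One_nat_def; (intro conjI)?; algebra)
qed
lemma fermat_jet_5: "fermat_jet c 5 = smult (c - 1) [:0, - (c ^ 3) + 9 * c ^ 2 - 26 * c + 24,
    11 * c ^ 3 - 34 * c ^ 2 + c + 46, - 11 * c ^ 3 - 11 * c ^ 2 + 29 * c + 29,
    c ^ 3 + 6 * c ^ 2 + 11 * c + 6:]"
proof -
  have eq: "fermat_jet c 5 = fermat_jet c (Suc 4)" by simp
  show ?thesis
    unfolding eq fermat_jet.simps(2) fermat_jet_4
    by (simp add: pderiv_pCons pderiv_smult del: One_nat_def; (intro conjI)?; algebra)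
qed
lemma fermat_jet_6: "fermat_jet c 6 = smult (c - 1) [:0,
    c ^ 4 - 14 * c ^ 3 + 71 * c ^ 2 - 154 * c + 120,
    - 26 * c ^ 4 + 155 * c ^ 3 - 240 * c ^ 2 - 95 * c + 326,
    66 * c ^ 4 - 80 * c ^ 3 - 275 * c ^ 2 + 200 * c + 329, - 26 * c ^ 4 - 85 * c ^ 3 + 205 * c + 146,
    c ^ 4 + 10 * c ^ 3 + 35 * c ^ 2 + 50 * c + 24:]"
proof -
  have eq: "fermat_jet c 6 = fermat_jet c (Suc 5)" by simp
  show ?thesis
    unfolding eq fermat_jet.simps(2) fermat_jet_5
    by (simp add: pderiv_pCons pderiv_smult del: One_nat_def; (intro conjI)?; algebra)
qed
lemma fermat_jet_7: "fermat_jet c 7 = smult (c - 1) [:0,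
    - (c ^ 5) + 20 * c ^ 4 - 155 * c ^ 3 + 580 * c ^ 2 - 1044 * c + 720,
    57 * c ^ 5 - 531 * c ^ 4 + 1695 * c ^ 3 - 1665 * c ^ 2 - 1392 * c + 2556,
    - 302 * c ^ 5 + 1126 * c ^ 4 + 160 * c ^ 3 - 3830 * c ^ 2 + 1042 * c + 3604,
    302 * c ^ 5 + 274 * c ^ 4 - 1735 * c ^ 3 - 1595 * c ^ 2 + 2633 * c + 2521,
    - 57 * c ^ 5 - 344 * c ^ 4 - 540 * c ^ 3 + 370 * c ^ 2 + 1497 * c + 874,
    c ^ 5 + 15 * c ^ 4 + 85 * c ^ 3 + 225 * c ^ 2 + 274 * c + 120:]"
proof -
  have eq: "fermat_jet c 7 = fermat_jet c (Suc 6)" by simp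
  show ?thesis
    unfolding eq fermat_jet.simps(2) fermat_jet_6
    by (simp add: pderiv_pCons pderiv_smult del: One_nat_def; (intro conjI)?; algebra)
qed
lemma fermat_jet_8: "fermat_jet c 8 = smult (c - 1) [:0,
    c ^ 6 - 27 * c ^ 5 + 295 * c ^ 4 - 1665 * c ^ 3 + 5104 * c ^ 2 - 8028 * c + 5040,
    - 120 * c ^ 6 + 1575 * c ^ 5 - 7917 * c ^ 4 + 17745 * c ^ 3 - 11655 * c ^ 2 - 16800 * c + 22212,
    1191 * c ^ 6 - 7805 * c ^ 5 + 12691 * c ^ 4 + 14455 * c ^ 3 - 46886 * c ^ 2 + 910 * c + 40564,
    - 2416 * c ^ 6 + 3710 * c ^ 5 + 16254 * c ^ 4 - 20125 * c ^ 3 - 40509 * c ^ 2 + 29015 * c + 39271,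
    1191 * c ^ 6 + 3955 * c ^ 5 - 3269 * c ^ 4 - 20825 * c ^ 3 - 6566 * c ^ 2 + 29470 * c + 21244,
    - 120 * c ^ 6 - 1113 * c ^ 5 - 3549 * c ^ 4 - 3255 * c ^ 3 + 5145 * c ^ 2 + 11928 * c + 6084,
    c ^ 6 + 21 * c ^ 5 + 175 * c ^ 4 + 735 * c ^ 3 + 1624 * c ^ 2 + 1764 * c + 720:]"
proof -
  have eq: "fermat_jet c 8 = fermat_jet c (Suc 7)" by simp
  show ?thesis
    unfolding eq fermat_jet.simps(2) fermat_jet_7
    by (simp add: pderiv_pCons pderiv_smult del: One_nat_def; (intro conjI)?; algebra)
qed


section \<open>Signatures of the Fermat curve\<close>

lemma eval2_const: "eval2 [:p:] (x, y) = poly p x"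
  by (simp add: eval2_def)

lemma tendsto_eval2: "(h \<longlongrightarrow> p) F \<Longrightarrow> ((\<lambda>t. eval2 P (h t)) \<longlongrightarrow> eval2 P p) F"
proof (induction P)
  case 0
  thus ?case by (simp add: eval2_def)
next
  case (pCons c P)
  have "eval2 (pCons c P) q = poly c (fst q) + snd q * eval2 P q" for q
    by (cases q) (simp add: eval2_pCons)
  thus ?case using pCons by (auto intro!: tendsto_intros)
qed

text \<open>Horner's scheme over a common denominator; it supplies the polynomials that
  \<open>regular_value\<close> asks for.\<close>

lemma poly_fraction:
  fixes f m n :: "complex poly"
  shows "\<exists>h k. \<forall>x. poly m x \<noteq> 0 \<longrightarrow> poly f (poly n x / poly m x) = poly h x / poly m x ^ k"
proof (induction f)
  case 0
  show ?case by (intro exI[of _ 0] exI[of _ 0]) simp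
next
  case (pCons a f)
  then obtain h k where hk: "\<forall>x. poly m x \<noteq> 0 \<longrightarrow> poly f (poly n x / poly m x) = poly h x / poly m x ^ k"
    by blast
  show ?case
    by (rule exI[of _ "smult a (m ^ Suc k) + n * h"], rule exI[of _ "Suc k"])
      (simp add: hk poly_power field_simps)
qed

section \<open>Finite exceptional sets and limits along the curve\<close>

lemma finite_complex_roots_vimage:
  assumes "finite (Z :: complex set)" "d > 0"
  shows "finite {x. x ^ d \<in> Z}"
proof -
  have "{x. x ^ d \<in> Z} = (\<Union>z\<in>Z. {x. x ^ d = z})" by auto
  thus ?thesis using assms finite_nth_roots by auto
qed

lemma finite_fermat_fiber:
  assumes "finite Z" "d > 0"
  shows "finite {q \<in> zero_locus (fermat d). fst q ^ d \<in> Z}"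
proof (rule finite_subset)
  show "{q \<in> zero_locus (fermat d). fst q ^ d \<in> Z}
      \<subseteq> {x. x ^ d \<in> Z} \<times> {y. y ^ d \<in> (\<lambda>z. - 1 - z) ` Z}"
    by (auto simp: in_fermat_iff)
  show "finite ({x. x ^ d \<in> Z} \<times> {y. y ^ d \<in> (\<lambda>z. - 1 - z) ` Z})"
    using assms by (intro finite_cartesian_product finite_complex_roots_vimage finite_imageI)
qed

text \<open>Where \<open>y \<noteq> 0\<close> the curve is locally a graph over \<open>x\<close>, so
  \<open>x\<close> can be moved freely.\<close>

lemma fermat_approach_graph:
  assumes p: "p \<in> zero_locus (fermat d)" and d: "d > 0" and B: "finite B" and y: "snd p \<noteq> 0"
  shows "\<exists>\<gamma>. (\<gamma> \<longlongrightarrow> p) (at (0::complex)) \<and> (\<forall>\<^sub>F t in at 0. \<gamma> t \<in> zero_locus (fermat d) - B)"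
proof -
  obtain U r where r: "open U" "snd p ^ d \<in> U" "r holomorphic_on U"
    "r (snd p ^ d) = snd p" "\<And>z. z \<in> U \<Longrightarrow> r z ^ d = z"
    by (rule holomorphic_root_branch[OF y d]) blast
  define h where "h = (\<lambda>t. - 1 - (fst p + t) ^ d)"
  have "(h \<longlongrightarrow> - 1 - (fst p + 0) ^ d) (at 0)" unfolding h_def by (intro tendsto_intros)
  hence h: "(h \<longlongrightarrow> snd p ^ d) (at 0)" using p by (cases p) (simp add: in_fermat_iff)
  have "isCont r (snd p ^ d)"
    using holomorphic_on_imp_continuous_on[OF r(3)] r(1,2) by (simp add: continuous_on_eq_continuous_at)
  hence "((\<lambda>t. r (h t)) \<longlongrightarrow> snd p) (at 0)" using isCont_tendsto_compose[OF _ h, of r] r(4) by simp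
  moreover have "((\<lambda>t. fst p + t) \<longlongrightarrow> fst p + 0) (at 0)" by (intro tendsto_intros)
  ultimately have "((\<lambda>t. (fst p + t, r (h t))) \<longlongrightarrow> (fst p, snd p)) (at 0)"
    by (intro tendsto_Pair) auto
  moreover have "\<forall>\<^sub>F t in at 0. h t \<in> U" using topological_tendstoD[OF h r(1,2)] .
  hence "\<forall>\<^sub>F t in at 0. (fst p + t, r (h t)) \<in> zero_locus (fermat d)"
    by eventually_elim (simp add: in_fermat_iff r(5), simp add: h_def)
  \<comment> \<open>Avoiding the first coordinates of \<open>B\<close> suffices; if \<open>p\<close>
    shares one of them, the punctured limit excludes \<open>t = 0\<close>.\<close>
  moreover have "\<forall>\<^sub>F t in at 0. \<forall>b\<in>B. t \<noteq> fst b - fst p"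
    using B by (intro eventually_ball_finite) (auto intro: eventually_neq_at_within)
  hence "\<forall>\<^sub>F t in at 0. (fst p + t, r (h t)) \<notin> B" by eventually_elim fastforce
  ultimately show ?thesis
    by (intro exI[of _ "\<lambda>t. (fst p + t, r (h t))"]) (auto intro: eventually_conj)
qed

text \<open>A point with \<open>y = 0\<close> has \<open>x \<noteq> 0\<close>, and the equation is
  symmetric, so swapping the coordinates reduces to the graph case.\<close>

lemma fermat_approach:
  assumes p: "p \<in> zero_locus (fermat d)" and d: "d > 0" and B: "finite B"
  shows "\<exists>\<gamma>. (\<gamma> \<longlongrightarrow> p) (at (0::complex)) \<and> (\<forall>\<^sub>F t in at 0. \<gamma> t \<in> zero_locus (fermat d) - B)"
proof (cases "snd p = 0")
  case False
  thus ?thesis using fermat_approach_graph assms by blast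
next
  case True
  have sym: "prod.swap q \<in> zero_locus (fermat d) \<longleftrightarrow> q \<in> zero_locus (fermat d)" for q
    by (cases q) (auto simp: zero_locus_def eval2_fermat add_ac)
  have "fst p \<noteq> 0"
  proof
    assume "fst p = 0"
    thus False using True p d by (cases p) (simp add: in_fermat_iff zero_power)
  qed
  then obtain \<gamma> where \<gamma>: "(\<gamma> \<longlongrightarrow> prod.swap p) (at (0::complex))"
      "\<forall>\<^sub>F t in at 0. \<gamma> t \<in> zero_locus (fermat d) - prod.swap ` B"
    using fermat_approach_graph[of "prod.swap p" d "prod.swap ` B"] p d B sym by auto
  have "((\<lambda>t. prod.swap (\<gamma> t)) \<longlongrightarrow> prod.swap (prod.swap p)) (at 0)"
    unfolding prod.swap_def using \<gamma>(1) by (intro tendsto_intros) (auto simp: prod.swap_def)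
  moreover have "prod.swap q \<in> zero_locus (fermat d) - B" if "q \<in> zero_locus (fermat d) - prod.swap ` B" for q
    using that sym by (metis DiffE DiffI image_eqI swap_swap)
  hence "\<forall>\<^sub>F t in at 0. prod.swap (\<gamma> t) \<in> zero_locus (fermat d) - B"
    by (rule eventually_mono[OF \<gamma>(2)])
  ultimately show ?thesis by auto
qed

text \<open>Outside \<open>Z\<close> the invariants are \<open>f\<close> and \<open>g\<close> at
  \<open>n / m\<close>, and since \<open>n / m\<close> is not constant this puts points for
  infinitely many parameters in the image. At other regular points only some representation by
  polynomials is known; continuity carries the equation of \<open>G\<close> over to them.\<close>

lemma signature_curve_fermat:
  fixes f g m n :: "complex poly"
  assumes d: "d > 0" and V: "zero_locus G = range (\<lambda>w. (poly f w, poly g w))"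
    and Z: "finite Z" and m: "\<And>X. X \<notin> Z \<Longrightarrow> poly m X \<noteq> 0"
    and nonconst: "\<And>w. n - smult w m \<noteq> 0"
    and val: "\<And>q. q \<in> zero_locus (fermat d) \<Longrightarrow> fst q ^ d \<notin> Z \<Longrightarrow>
      eval2 (pderiv (fermat d)) q \<noteq> 0 \<and> M1 (curve_jet (fermat d) q) \<noteq> 0 \<and> M2 (curve_jet (fermat d) q) \<noteq> 0
      \<and> N1 (curve_jet (fermat d) q) / M1 (curve_jet (fermat d) q) = poly f (poly n (fst q ^ d) / poly m (fst q ^ d))
      \<and> N2 (curve_jet (fermat d) q) / M2 (curve_jet (fermat d) q) = poly g (poly n (fst q ^ d) / poly m (fst q ^ d))"
  shows "signature_curve (fermat d) ((N1, M1), (N2, M2)) = zero_locus G"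
proof -
  let ?F = "fermat d"
  let ?S = "signature_image ?F ((N1, M1), (N2, M2))"
  define w where "w X = poly n X / poly m X" for X
  have regular: "regular_value ?F (N, M) p (poly h (w (fst p ^ d)))"
    if p: "p \<in> zero_locus ?F" "fst p ^ d \<notin> Z"
      and NM: "\<And>q. q \<in> zero_locus ?F \<Longrightarrow> fst q ^ d \<notin> Z \<Longrightarrow> eval2 (pderiv ?F) q \<noteq> 0 \<and> M (curve_jet ?F q) \<noteq> 0
        \<and> N (curve_jet ?F q) / M (curve_jet ?F q) = poly h (w (fst q ^ d))" for N M h p
  proof -
    obtain a k where ak: "\<forall>x. poly m x \<noteq> 0 \<longrightarrow> poly h (poly n x / poly m x) = poly a x / poly m x ^ k"
      using poly_fraction by blast
    define P where "P = [:pcompose a (monom 1 d):]"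
    define Q where "Q = [:pcompose (m ^ k) (monom 1 d):]"
    have P: "eval2 P q = poly a (fst q ^ d)" for q
      by (cases q) (simp add: P_def eval2_const poly_pcompose poly_monom)
    have Q: "eval2 Q q = poly m (fst q ^ d) ^ k" for q
      by (cases q) (simp add: Q_def eval2_const poly_pcompose poly_monom poly_power)
    have PQ: "eval2 Q q \<noteq> 0 \<and> poly h (w (fst q ^ d)) = eval2 P q / eval2 Q q" if "fst q ^ d \<notin> Z" for q
      using m[OF that] ak by (simp add: P Q w_def)
    have "{q \<in> zero_locus ?F. \<not> (eval2 (pderiv ?F) q \<noteq> 0 \<and> M (curve_jet ?F q) \<noteq> 0 \<and> eval2 Q q \<noteq> 0
        \<and> N (curve_jet ?F q) / M (curve_jet ?F q) = eval2 P q / eval2 Q q)}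
        \<subseteq> {q \<in> zero_locus ?F. fst q ^ d \<in> Z}" (is "?A \<subseteq> _")
      using NM PQ by auto
    hence "finite ?A" using finite_fermat_fiber[OF Z d] finite_subset by blast
    thus ?thesis unfolding regular_value_def fst_conv snd_conv using PQ[OF p(2)] by blast
  qed
  have sub: "?S \<subseteq> zero_locus G"
  proof
    fix z assume "z \<in> ?S"
    then obtain a b p where z: "z = (a, b)" and p: "p \<in> zero_locus ?F"
      and ra: "regular_value ?F (N1, M1) p a" and rb: "regular_value ?F (N2, M2) p b"
      by (auto simp: signature_image_def)
    obtain P1 Q1 where 1: "eval2 Q1 p \<noteq> 0" "a = eval2 P1 p / eval2 Q1 p"
      "finite {q \<in> zero_locus ?F. \<not> (eval2 (pderiv ?F) q \<noteq> 0 \<and> M1 (curve_jet ?F q) \<noteq> 0 \<and> eval2 Q1 q \<noteq> 0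
        \<and> N1 (curve_jet ?F q) / M1 (curve_jet ?F q) = eval2 P1 q / eval2 Q1 q)}" (is "finite ?B1")
      using ra unfolding regular_value_def by auto
    obtain P2 Q2 where 2: "eval2 Q2 p \<noteq> 0" "b = eval2 P2 p / eval2 Q2 p"
      "finite {q \<in> zero_locus ?F. \<not> (eval2 (pderiv ?F) q \<noteq> 0 \<and> M2 (curve_jet ?F q) \<noteq> 0 \<and> eval2 Q2 q \<noteq> 0
        \<and> N2 (curve_jet ?F q) / M2 (curve_jet ?F q) = eval2 P2 q / eval2 Q2 q)}" (is "finite ?B2")
      using rb unfolding regular_value_def by auto
    \<comment> \<open>Off \<open>?B\<close> both chosen representations are valid and agree with the
      formulas in \<open>val\<close>.\<close>
    let ?B = "?B1 \<union> ?B2 \<union> {q \<in> zero_locus ?F. fst q ^ d \<in> Z}"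
    have "finite ?B" using 1(3) 2(3) finite_fermat_fiber[OF Z d] by blast
    from fermat_approach[OF p d this] obtain \<gamma> where \<gamma>: "(\<gamma> \<longlongrightarrow> p) (at (0::complex))"
      "\<forall>\<^sub>F t in at 0. \<gamma> t \<in> zero_locus ?F - ?B" by blast
    define \<Phi> where "\<Phi> q = (eval2 P1 q / eval2 Q1 q, eval2 P2 q / eval2 Q2 q)" for q
    have "((\<lambda>t. \<Phi> (\<gamma> t)) \<longlongrightarrow> z) (at 0)"
      unfolding \<Phi>_def z 1(2) 2(2) using 1(1) 2(1) by (intro tendsto_intros tendsto_eval2 \<gamma>(1))
    hence lim: "((\<lambda>t. eval2 G (\<Phi> (\<gamma> t))) \<longlongrightarrow> eval2 G z) (at 0)" by (rule tendsto_eval2)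
    have "eval2 G (\<Phi> q) = 0" if q: "q \<in> zero_locus ?F - ?B" for q
    proof -
      have "\<Phi> q = (poly f (w (fst q ^ d)), poly g (w (fst q ^ d)))"
        using q val[of q] by (auto simp: \<Phi>_def w_def)
      hence "\<Phi> q \<in> zero_locus G" by (auto simp: V)
      thus ?thesis by (simp add: zero_locus_def)
    qed
    hence "\<forall>\<^sub>F t in at 0. eval2 G (\<Phi> (\<gamma> t)) = 0" by (rule eventually_mono[OF \<gamma>(2)])
    hence "((\<lambda>t. eval2 G (\<Phi> (\<gamma> t))) \<longlongrightarrow> 0) (at 0)" by (rule tendsto_eventually)
    hence "eval2 G z = 0" using tendsto_unique[OF _ lim] by simp
    thus "z \<in> zero_locus G" by (simp add: zero_locus_def)
  qed
  have "w ` (- Z) \<subseteq> {w. (poly f w, poly g w) \<in> ?S}"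
  proof clarify
    fix X assume X: "X \<notin> Z"
    obtain x where x: "x ^ d = X" using exists_complex_root d by (metis less_irrefl)
    obtain y where y: "y ^ d = - 1 - X" using exists_complex_root d by (metis less_irrefl)
    have p: "(x, y) \<in> zero_locus ?F" using x y by (simp add: in_fermat_iff)
    have "regular_value ?F (N1, M1) (x, y) (poly f (w X))" "regular_value ?F (N2, M2) (x, y) (poly g (w X))"
      using regular[of "(x, y)" M1 N1 f] regular[of "(x, y)" M2 N2 g] val p x X by (simp_all add: w_def)
    thus "(poly f (w X), poly g (w X)) \<in> ?S" using p by (auto simp: signature_image_def)
  qed
  moreover have "infinite (w ` (- Z))"
  proof
    assume fin: "finite (w ` (- Z))"
    \<comment> \<open>Each value of \<open>w\<close> is attained at finitely many points only, so
      finitely many values would make \<open>- Z\<close> finite.\<close>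
    have "- Z \<subseteq> (\<Union>v\<in>w ` (- Z). {X. poly (n - smult v m) X = 0})"
      using m by (auto simp: w_def)
    moreover have "finite (\<Union>v\<in>w ` (- Z). {X. poly (n - smult v m) X = 0})"
      using fin nonconst poly_roots_finite by blast
    ultimately have "finite (- Z)" by (rule finite_subset)
    thus False using Z infinite_UNIV_char_0 by (metis Compl_eq_Diff_UNIV finite_Diff2)
  qed
  ultimately have "infinite {w. (poly f w, poly g w) \<in> ?S}" using finite_subset by blast
  thus ?thesis unfolding signature_curve_def by (rule zariski_closure_parametrized[OF V sub])
qed


section \<open>Values of the differential invariants\<close>

text \<open>All terms of one of these functions have the same degree in the jet and a total order of
  differentiation three times that degree. The resulting powers of \<open>a\<close> and
  \<open>b\<close> cancel in both pairs of invariants.\<close>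

lemma Theta_scale:
  fixes a b :: complex
  assumes "\<And>n. n \<ge> 2 \<Longrightarrow> u n = a * b ^ n * q n"
  shows "\<Theta>4 u = a ^ 2 * b ^ 6 * \<Theta>4 q" "\<Theta>5 u = a ^ 3 * b ^ 9 * \<Theta>5 q"
    "\<Theta>6 u = a ^ 4 * b ^ 12 * \<Theta>6 q"  "\<Theta>7 u = a ^ 8 * b ^ 24 * \<Theta>7 q" "\<Theta>8 u = a ^ 12 * b ^ 36 * \<Theta>8 q"
proof -
  have u: "u 2 = a * b ^ 2 * q 2" "u 3 = a * b ^ 3 * q 3" "u 4 = a * b ^ 4 * q 4" "u 5 = a * b ^ 5 * q 5"
    "u 6 = a * b ^ 6 * q 6" "u 7 = a * b ^ 7 * q 7" "u 8 = a * b ^ 8 * q 8"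
    by (simp_all add: assms)
  show "\<Theta>4 u = a ^ 2 * b ^ 6 * \<Theta>4 q" "\<Theta>5 u = a ^ 3 * b ^ 9 * \<Theta>5 q"
    "\<Theta>6 u = a ^ 4 * b ^ 12 * \<Theta>6 q"
    unfolding u \<Theta>4_def \<Theta>5_def \<Theta>6_def by algebra+
  show "\<Theta>7 u = a ^ 8 * b ^ 24 * \<Theta>7 q"
    unfolding u \<Theta>7_def \<Theta>5_def by (simp; algebra)
  show "\<Theta>8 u = a ^ 12 * b ^ 36 * \<Theta>8 q"
    unfolding u \<Theta>8_def \<Theta>5_def by (simp; algebra)
qed

text \<open>With the second derivative scaled to 1 and the third equal to \<open>3 * k\<close>, the shear
  \<open>x \<mapsto> x + k * y\<close> removes the third derivative and turns the higher ones into \<open>s4, \<dots>, s8\<close>. The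
  differential functions are relative affine invariants, so they do not see \<open>k\<close>.\<close>

lemma Theta_normal_form:
  fixes q :: "nat \<Rightarrow> complex"
  assumes "q 2 = 1" "q 3 = 3 * k" "q 4 = s4 + 15 * k ^ 2" "q 5 = s5 + 15 * s4 * k + 105 * k ^ 3"
    "q 6 = s6 + 21 * s5 * k + 210 * s4 * k ^ 2 + 945 * k ^ 4"
    "q 7 = s7 + 28 * s6 * k + 35 * s4 ^ 2 * k + 378 * s5 * k ^ 2 + 3150 * s4 * k ^ 3 + 10395 * k ^ 5"
    "q 8 = s8 + 36 * s7 * k + 126 * s4 * s5 * k + 630 * s6 * k ^ 2 + 1575 * s4 ^ 2 * k ^ 2
       + 6930 * s5 * k ^ 3 + 51975 * s4 * k ^ 4 + 135135 * k ^ 6"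
  shows "\<Theta>4 q = 3 * s4" "\<Theta>5 q = 9 * s5" "\<Theta>6 q = 9 * s6 - 45 * s4 ^ 2"
    "2 * \<Theta>7 q = 1458 * s5 * s7 - 1701 * s6 ^ 2 - 25515 * s4 * s5 ^ 2 + 17010 * s4 ^ 2 * s6 - 42525 * s4 ^ 4"
    "2 * \<Theta>8 q = -157464 * s5 * s6 * s7 + 39366 * s5 ^ 2 * s8 + 122472 * s6 ^ 3 + 1653372 * s4 * s5 ^ 2 * s6
       + 787320 * s4 ^ 2 * s5 * s7 - 1837080 * s4 ^ 2 * s6 ^ 2 - 688905 * s5 ^ 4
       - 10563210 * s4 ^ 3 * s5 ^ 2 + 9185400 * s4 ^ 4 * s6 - 15309000 * s4 ^ 6"
  unfolding \<Theta>4_def \<Theta>5_def \<Theta>6_def \<Theta>7_def \<Theta>8_def assms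
  by (simp; algebra)+

text \<open>With \<open>X = x ^ d\<close> and \<open>Y = y ^ d = - 1 - X\<close> we have \<open>e = X * Y\<close> and \<open>D = X - Y\<close>: by the symmetry
  exchanging \<open>x\<close> and \<open>y\<close>, the normalised derivatives are polynomials in \<open>e\<close>, times \<open>D\<close> in odd order.
  The factor \<open>3 ^ n / 9\<close> makes them integral.\<close>

lemma Theta_fermat_jet:
  fixes q :: "nat \<Rightarrow> complex" and c X :: complex
  assumes q: "\<And>n. 9 * (c - 1) * X * q n = 3 ^ n * poly (fermat_jet c n) X" and nz: "c \<noteq> 1" "X \<noteq> 0"
    and e: "e = X * (- 1 - X)" and D: "D = 2 * X + 1" and C: "C = (2 * c - 1) * (c - 2) * (c + 1)"
  shows "\<Theta>4 q = 9 * ((2 * c - 1) * ((c + 1) * e - (c - 2)))"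
    "\<Theta>5 q = - 27 * (C * (e + 2) * D)"
    "\<Theta>6 q = 81 * (C * ((4 - 2 * c) * e ^ 2 + (7 + 4 * c) * e - (2 + 2 * c)))"
    "2 * \<Theta>7 q = 3 ^ 8 * (9 * C ^ 2 * (1 - e)
       * ((4 - 4 * c + 4 * c ^ 2) * (1 - e) ^ 3 - (27 - 27 * c + 90 * c ^ 2) * e ^ 2))"
    "2 * \<Theta>8 q = 3 ^ 12 * (243 * c * C ^ 3 * e ^ 2
       * ((4 - 4 * c - 24 * c ^ 2) * (1 - e) ^ 3 - (27 - 27 * c + 90 * c ^ 2) * e ^ 2))"
proof -
  have X: "9 * (c - 1) * X \<noteq> 0" using nz by simp

  have q2: "q 2 = 1"
    by (rule mult_left_cancel[OF X, THEN iffD1], unfold q fermat_jet_2 poly_smult poly_pCons poly_0) algebra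
  have q3: "q 3 = 3 * poly [:- c + 2, c + 1:] X"
    by (rule mult_left_cancel[OF X, THEN iffD1], unfold q fermat_jet_3 poly_smult poly_pCons poly_0) algebra
  have q4: "q 4 = 9 * poly [:c ^ 2 - 5 * c + 6, - 4 * c ^ 2 + 3 * c + 7, c ^ 2 + 3 * c + 2:] X"
    by (rule mult_left_cancel[OF X, THEN iffD1], unfold q fermat_jet_4 poly_smult poly_pCons poly_0) algebra
  have q5: "q 5 = 27 * poly [:- (c ^ 3) + 9 * c ^ 2 - 26 * c + 24, 11 * c ^ 3 - 34 * c ^ 2 + c + 46,
      - 11 * c ^ 3 - 11 * c ^ 2 + 29 * c + 29, c ^ 3 + 6 * c ^ 2 + 11 * c + 6:] X"
    by (rule mult_left_cancel[OF X, THEN iffD1], unfold q fermat_jet_5 poly_smult poly_pCons poly_0) algebra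
  have q6: "q 6 = 81 * poly [:c ^ 4 - 14 * c ^ 3 + 71 * c ^ 2 - 154 * c + 120,
      - 26 * c ^ 4 + 155 * c ^ 3 - 240 * c ^ 2 - 95 * c + 326,
      66 * c ^ 4 - 80 * c ^ 3 - 275 * c ^ 2 + 200 * c + 329, - 26 * c ^ 4 - 85 * c ^ 3 + 205 * c + 146,
      c ^ 4 + 10 * c ^ 3 + 35 * c ^ 2 + 50 * c + 24:] X"
    by (rule mult_left_cancel[OF X, THEN iffD1], unfold q fermat_jet_6 poly_smult poly_pCons poly_0) algebra
  have q7: "q 7 = 243 * poly [:- (c ^ 5) + 20 * c ^ 4 - 155 * c ^ 3 + 580 * c ^ 2 - 1044 * c + 720,
      57 * c ^ 5 - 531 * c ^ 4 + 1695 * c ^ 3 - 1665 * c ^ 2 - 1392 * c + 2556,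
      - 302 * c ^ 5 + 1126 * c ^ 4 + 160 * c ^ 3 - 3830 * c ^ 2 + 1042 * c + 3604,
      302 * c ^ 5 + 274 * c ^ 4 - 1735 * c ^ 3 - 1595 * c ^ 2 + 2633 * c + 2521,
      - 57 * c ^ 5 - 344 * c ^ 4 - 540 * c ^ 3 + 370 * c ^ 2 + 1497 * c + 874,
      c ^ 5 + 15 * c ^ 4 + 85 * c ^ 3 + 225 * c ^ 2 + 274 * c + 120:] X"
    by (rule mult_left_cancel[OF X, THEN iffD1], unfold q fermat_jet_7 poly_smult poly_pCons poly_0) algebra
  have q8: "q 8 = 729 * poly [:c ^ 6 - 27 * c ^ 5 + 295 * c ^ 4 - 1665 * c ^ 3 + 5104 * c ^ 2 - 8028 * c + 5040,
      - 120 * c ^ 6 + 1575 * c ^ 5 - 7917 * c ^ 4 + 17745 * c ^ 3 - 11655 * c ^ 2 - 16800 * c + 22212,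
      1191 * c ^ 6 - 7805 * c ^ 5 + 12691 * c ^ 4 + 14455 * c ^ 3 - 46886 * c ^ 2 + 910 * c + 40564,
      - 2416 * c ^ 6 + 3710 * c ^ 5 + 16254 * c ^ 4 - 20125 * c ^ 3 - 40509 * c ^ 2 + 29015 * c + 39271,
      1191 * c ^ 6 + 3955 * c ^ 5 - 3269 * c ^ 4 - 20825 * c ^ 3 - 6566 * c ^ 2 + 29470 * c + 21244,
      - 120 * c ^ 6 - 1113 * c ^ 5 - 3549 * c ^ 4 - 3255 * c ^ 3 + 5145 * c ^ 2 + 11928 * c + 6084,
      c ^ 6 + 21 * c ^ 5 + 175 * c ^ 4 + 735 * c ^ 3 + 1624 * c ^ 2 + 1764 * c + 720:] X"
    by (rule mult_left_cancel[OF X, THEN iffD1], unfold q fermat_jet_8 poly_smult poly_pCons poly_0) algebra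
  \<comment> \<open>\<open>k\<close> is a third of \<open>q 3\<close>, and \<open>s4\<close> to
    \<open>s8\<close> solve the equations of \<open>Theta_normal_form\<close> one after the
    other.\<close>
  define k where "k = (c + 1) * X - c + 2"
  define s4 where "s4 = ((- 6 * c ^ 2 + 15 * c - 6) + (6 * c ^ 2 + 3 * c - 3) * e)"
  define s5 where "s5 = 3 * ((- 4 * c ^ 3 + 6 * c ^ 2 + 6 * c - 4)
      + (- 2 * c ^ 3 + 3 * c ^ 2 + 3 * c - 2) * e) * D"
  define s6 where "s6 = 9 * ((16 * c ^ 4 - 98 * c ^ 3 + 177 * c ^ 2 - 98 * c + 16)
      + (- 32 * c ^ 4 + 82 * c ^ 3 - 3 * c ^ 2 - 83 * c + 34) * e
      + (16 * c ^ 4 + 34 * c ^ 3 - 21 * c ^ 2 - 26 * c + 13) * e ^ 2)"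
  define s7 where "s7 = 27 * ((40 * c ^ 5 - 184 * c ^ 4 + 166 * c ^ 3 + 166 * c ^ 2 - 184 * c + 40)
      + (- 20 * c ^ 5 - 34 * c ^ 4 + 190 * c ^ 3 - 20 * c ^ 2 - 160 * c + 64) * e
      + (- 20 * c ^ 5 + 8 * c ^ 4 + 85 * c ^ 3 - 20 * c ^ 2 - 55 * c + 22) * e ^ 2) * D"
  define s8 where "s8 = 81 * ((- 64 * c ^ 6 + 852 * c ^ 5 - 3432 * c ^ 4 + 5479 * c ^ 3 - 3432 * c ^ 2 + 852 * c - 64)
      + (192 * c ^ 6 - 1452 * c ^ 5 + 3252 * c ^ 4 - 1221 * c ^ 3 - 3153 * c ^ 2 + 2496 * c - 468) * e
      + (- 372 * c ^ 6 + 708 * c ^ 5 + 1191 * c ^ 4 - 2484 * c ^ 3 - 237 * c ^ 2 + 1758 * c - 600) * e ^ 2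
      + (64 * c ^ 6 + 468 * c ^ 5 + 132 * c ^ 4 - 1009 * c ^ 3 + 27 * c ^ 2 + 573 * c - 191) * e ^ 3)"
  \<comment> \<open>In \<open>\<Theta>7\<close> and \<open>\<Theta>8\<close> the factor
    \<open>D\<close> occurs to even powers only, which this turns into polynomials in
    \<open>e\<close>.\<close>
  have D2: "D ^ 2 = 1 - 4 * e" unfolding D e by algebra
  have nf: "q 2 = 1" "q 3 = 3 * k" "q 4 = s4 + 15 * k ^ 2" "q 5 = s5 + 15 * s4 * k + 105 * k ^ 3"
    "q 6 = s6 + 21 * s5 * k + 210 * s4 * k ^ 2 + 945 * k ^ 4"
    "q 7 = s7 + 28 * s6 * k + 35 * s4 ^ 2 * k + 378 * s5 * k ^ 2 + 3150 * s4 * k ^ 3 + 10395 * k ^ 5"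
    "q 8 = s8 + 36 * s7 * k + 126 * s4 * s5 * k + 630 * s6 * k ^ 2 + 1575 * s4 ^ 2 * k ^ 2
       + 6930 * s5 * k ^ 3 + 51975 * s4 * k ^ 4 + 135135 * k ^ 6"
    unfolding q2 q3 q4 q5 q6 q7 q8 s4_def s5_def s6_def s7_def s8_def e D k_def poly_pCons poly_0
    by (simp; algebra)+
  note T = Theta_normal_form[OF nf]
  show "\<Theta>4 q = 9 * ((2 * c - 1) * ((c + 1) * e - (c - 2)))" unfolding T s4_def by algebra
  show "\<Theta>5 q = - 27 * (C * (e + 2) * D)" unfolding T s5_def C by algebra
  show "\<Theta>6 q = 81 * (C * ((4 - 2 * c) * e ^ 2 + (7 + 4 * c) * e - (2 + 2 * c)))" unfolding T s4_def s6_def C by algebra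
  show "2 * \<Theta>7 q = 3 ^ 8 * (9 * C ^ 2 * (1 - e)
       * ((4 - 4 * c + 4 * c ^ 2) * (1 - e) ^ 3 - (27 - 27 * c + 90 * c ^ 2) * e ^ 2))"
   unfolding T s4_def s5_def s6_def s7_def C using D2 by algebra
  show "2 * \<Theta>8 q = 3 ^ 12 * (243 * c * C ^ 3 * e ^ 2
       * ((4 - 4 * c - 24 * c ^ 2) * (1 - e) ^ 3 - (27 - 27 * c + 90 * c ^ 2) * e ^ 2))"
   unfolding T s4_def s5_def s6_def s7_def s8_def C using D2 by algebra
qed

text \<open>The scale factors are only claimed to be nonzero, since they cancel in the
  invariants.\<close>

lemma Theta_fermat:
  fixes c :: complex
  assumes p: "(x, y) \<in> zero_locus (fermat d)" and d: "d \<ge> 3"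
    and X: "X = x ^ d" "X \<noteq> 0" "X \<noteq> - 1"
    and c: "c = of_nat d" and e: "e = X * (- 1 - X)" and D: "D = 2 * X + 1"
    and C: "C = (2 * c - 1) * (c - 2) * (c + 1)"
  defines "u \<equiv> curve_jet (fermat d) (x, y)"
  obtains a b where "a \<noteq> 0" "b \<noteq> 0"
    "\<Theta>4 u = a ^ 2 * b ^ 6 * (9 * ((2 * c - 1) * ((c + 1) * e - (c - 2))))"
    "\<Theta>5 u = a ^ 3 * b ^ 9 * (- 27 * (C * (e + 2) * D))"
    "\<Theta>6 u = a ^ 4 * b ^ 12 * (81 * (C * ((4 - 2 * c) * e ^ 2 + (7 + 4 * c) * e - (2 + 2 * c))))"
    "2 * \<Theta>7 u = a ^ 8 * b ^ 24 * (3 ^ 8 * (9 * C ^ 2 * (1 - e)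
       * ((4 - 4 * c + 4 * c ^ 2) * (1 - e) ^ 3 - (27 - 27 * c + 90 * c ^ 2) * e ^ 2)))"
    "2 * \<Theta>8 u = a ^ 12 * b ^ 36 * (3 ^ 12 * (243 * c * C ^ 3 * e ^ 2
       * ((4 - 4 * c - 24 * c ^ 2) * (1 - e) ^ 3 - (27 - 27 * c + 90 * c ^ 2) * e ^ 2)))"
proof -
  have x0: "x \<noteq> 0" using X d by auto
  have Y0: "- 1 - X \<noteq> 0" using X(3) by (metis add_diff_cancel_right' diff_0 eq_iff_diff_eq_0 minus_diff_eq uminus_add_conv_diff)
  have y0: "y \<noteq> 0" using p X d by (auto simp: in_fermat_iff zero_power eq_neg_iff_add_eq_0 algebra_simps)
  have c1: "c \<noteq> 1" using d c by auto
  \<comment> \<open>\<open>a * b ^ n\<close> undoes the normalisation of \<open>q\<close> and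
    restores the factor \<open>y / (x * (- 1 - X)) ^ n\<close>.\<close>
  define a where "a = 9 * (c - 1) * X * y"
  define b where "b = 1 / (3 * (x * (- 1 - X)))"
  define q where "q n = 3 ^ n * poly (fermat_jet c n) X / (9 * (c - 1) * X)" for n
  have q: "9 * (c - 1) * X * q n = 3 ^ n * poly (fermat_jet c n) X" for n
    using c1 X by (simp add: q_def)
  have u: "u n = a * b ^ n * q n" for n
  proof -
    have "u n = y / (x * (- 1 - X)) ^ n * poly (fermat_jet c n) X"
      unfolding u_def c X(1) using curve_jet_fermat[OF p x0 y0] d by simp
    also have "\<dots> = y * b ^ n * (3 ^ n * poly (fermat_jet c n) X)"
      by (simp add: b_def power_divide power_mult_distrib)
    also have "\<dots> = a * b ^ n * q n" unfolding q[symmetric] a_def by simp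
    finally show ?thesis .
  qed
  note scale = Theta_scale[OF u] and val = Theta_fermat_jet[OF q c1 X(2) e D C]
  show ?thesis
  proof (rule that)
    show "a \<noteq> 0" "b \<noteq> 0" using c1 X(2) y0 x0 Y0 by (auto simp: a_def b_def)
    show "2 * \<Theta>7 u = a ^ 8 * b ^ 24 * (3 ^ 8 * (9 * C ^ 2 * (1 - e)
       * ((4 - 4 * c + 4 * c ^ 2) * (1 - e) ^ 3 - (27 - 27 * c + 90 * c ^ 2) * e ^ 2)))"
      unfolding scale val(4)[symmetric] by simp
    show "2 * \<Theta>8 u = a ^ 12 * b ^ 36 * (3 ^ 12 * (243 * c * C ^ 3 * e ^ 2
       * ((4 - 4 * c - 24 * c ^ 2) * (1 - e) ^ 3 - (27 - 27 * c + 90 * c ^ 2) * e ^ 2)))"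
      unfolding scale val(5)[symmetric] by simp
  qed (simp_all only: scale val)
qed

text \<open>\<open>b\<close> is the varying factor of \<open>\<Theta>4\<close>. Since
  \<open>(c + 1) * (e + 2) = b + 3 * c\<close> and
  \<open>(c + 1) * (1 - 4 * e) = 3 * (3 - c) - 4 * b\<close>, division by powers of \<open>b\<close>
  leaves polynomials in \<open>1 / b\<close>.\<close>

lemma affine_invariants_fermat_param:
  fixes c e b :: complex
  assumes b: "b = (c + 1) * e - (c - 2)" "b \<noteq> 0" and c: "2 * c - 1 \<noteq> 0" "c + 1 \<noteq> 0"
    and C: "C = (2 * c - 1) * (c - 2) * (c + 1)"
  shows "C ^ 2 * (e + 2) ^ 2 * (1 - 4 * e) / ((2 * c - 1) * b) ^ 3
      = (c - 2) ^ 2 / ((2 * c - 1) * (c + 1)) * ((1 + 3 * c * (1 / b)) ^ 2 * (3 * (3 - c) * (1 / b) - 4))"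
    and "C * ((4 - 2 * c) * e ^ 2 + (7 + 4 * c) * e - (2 + 2 * c)) / ((2 * c - 1) * b) ^ 2
      = (c - 2) / ((2 * c - 1) * (c + 1))
        * (9 * c * (c - 5) * (1 / b) ^ 2 + (27 * c - 9) * (1 / b) - 2 * (c - 2))"
proof -
  have 1: "1 + 3 * c * (1 / b) = (c + 1) * (e + 2) / b" "3 * (3 - c) * (1 / b) - 4 = (c + 1) * (1 - 4 * e) / b"
    using b(2) by (simp_all add: field_simps) (simp_all add: b(1) algebra_simps)
  show "C ^ 2 * (e + 2) ^ 2 * (1 - 4 * e) / ((2 * c - 1) * b) ^ 3
      = (c - 2) ^ 2 / ((2 * c - 1) * (c + 1)) * ((1 + 3 * c * (1 / b)) ^ 2 * (3 * (3 - c) * (1 / b) - 4))"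
    unfolding 1 C using b(2) c by (simp add: divide_simps) algebra
  have 2: "9 * c * (c - 5) * (1 / b) ^ 2 + (27 * c - 9) * (1 / b) - 2 * (c - 2)
      = (c + 1) ^ 2 * ((4 - 2 * c) * e ^ 2 + (7 + 4 * c) * e - (2 + 2 * c)) / b ^ 2"
  proof -
    have "9 * c * (c - 5) * (1 / b) ^ 2 + (27 * c - 9) * (1 / b) - 2 * (c - 2)
        = (9 * c * (c - 5) + (27 * c - 9) * b - 2 * (c - 2) * b ^ 2) / b ^ 2"
      using b(2) by (simp add: divide_simps power2_eq_square)
    also have "9 * c * (c - 5) + (27 * c - 9) * b - 2 * (c - 2) * b ^ 2
        = (c + 1) ^ 2 * ((4 - 2 * c) * e ^ 2 + (7 + 4 * c) * e - (2 + 2 * c))"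
      unfolding b(1) by algebra
    finally show ?thesis .
  qed
  show "C * ((4 - 2 * c) * e ^ 2 + (7 + 4 * c) * e - (2 + 2 * c)) / ((2 * c - 1) * b) ^ 2
      = (c - 2) / ((2 * c - 1) * (c + 1))
        * (9 * c * (c - 5) * (1 / b) ^ 2 + (27 * c - 9) * (1 / b) - 2 * (c - 2))"
    unfolding 2 C using b(2) c by (simp add: divide_simps) algebra
qed

lemma projective_invariants_fermat_param:
  fixes c e :: complex
  assumes H: "H = (1 - 4 * e) * (e + 2) ^ 2" "H \<noteq> 0" and C: "C \<noteq> 0"
    and w: "w = (1 - e) ^ 3 / H" and \<rho>: "\<rho> = 3 - 3 * c + 10 * c ^ 2"
  shows "729 / 8 * ((1 - e) * ((4 - 4 * c + 4 * c ^ 2) * (1 - e) ^ 3 - (27 - 27 * c + 90 * c ^ 2) * e ^ 2)) ^ 3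
        / (C ^ 2 * H ^ 4)
      = 27 / (8 * C ^ 2) * (w * (\<rho> - 28 * c ^ 2 * w) ^ 3)"
    and "243 / 2 * (c * e ^ 2 * ((4 - 4 * c - 24 * c ^ 2) * (1 - e) ^ 3 - (27 - 27 * c + 90 * c ^ 2) * e ^ 2))
        / (C * H ^ 2)
      = 3 * c / (2 * C) * ((4 * w - 1) * (\<rho> - 112 * c ^ 2 * w))"
proof -
  have e1: "(1 - e) ^ 3 = w * H" using w H(2) by simp
  \<comment> \<open>By this identity and \<open>e1\<close>, every linear combination of
    \<open>(1 - e) ^ 3\<close> and \<open>e ^ 2\<close> is \<open>H\<close> times a polynomial of
    degree at most 1 in \<open>w\<close>.\<close>
  have e2: "27 * e ^ 2 = (4 * w - 1) * H"
  proof -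
    have "27 * e ^ 2 = 4 * (1 - e) ^ 3 - H" unfolding H by algebra
    thus ?thesis unfolding e1 by algebra
  qed
  have 7: "3 * ((4 - 4 * c + 4 * c ^ 2) * (1 - e) ^ 3 - (27 - 27 * c + 90 * c ^ 2) * e ^ 2) = H * (\<rho> - 28 * c ^ 2 * w)"
    unfolding e1 \<rho> using e2 by algebra
  have 8: "3 * ((4 - 4 * c - 24 * c ^ 2) * (1 - e) ^ 3 - (27 - 27 * c + 90 * c ^ 2) * e ^ 2) = H * (\<rho> - 112 * c ^ 2 * w)"
    unfolding e1 \<rho> using e2 by algebra
  let ?P = "(4 - 4 * c + 4 * c ^ 2) * (1 - e) ^ 3 - (27 - 27 * c + 90 * c ^ 2) * e ^ 2"
  \<comment> \<open>Cubing turns the single factor \<open>1 - e\<close> of \<open>\<Theta>7\<close>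
    into \<open>(1 - e) ^ 3 = w * H\<close>.\<close>
  have "27 * ((1 - e) * ?P) ^ 3 = (1 - e) ^ 3 * (3 * ?P) ^ 3" by algebra
  also have "\<dots> = w * (\<rho> - 28 * c ^ 2 * w) ^ 3 * H ^ 4" unfolding 7 unfolding e1 by algebra
  finally have K: "27 * ((1 - e) * ?P) ^ 3 = w * (\<rho> - 28 * c ^ 2 * w) ^ 3 * H ^ 4" .
  have "729 / 8 * ((1 - e) * ?P) ^ 3 / (C ^ 2 * H ^ 4) = 27 / 8 * (27 * ((1 - e) * ?P) ^ 3) / (C ^ 2 * H ^ 4)"
    by simp
  also have "\<dots> = 27 / (8 * C ^ 2) * (w * (\<rho> - 28 * c ^ 2 * w) ^ 3)"
    unfolding K using C H(2) by simp
  finally show "729 / 8 * ((1 - e) * ?P) ^ 3 / (C ^ 2 * H ^ 4) = 27 / (8 * C ^ 2) * (w * (\<rho> - 28 * c ^ 2 * w) ^ 3)" .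
  let ?R = "(4 - 4 * c - 24 * c ^ 2) * (1 - e) ^ 3 - (27 - 27 * c + 90 * c ^ 2) * e ^ 2"
  have "243 / 2 * (c * e ^ 2 * ?R) = 3 / 2 * c * (27 * e ^ 2) * (3 * ?R)" by simp
  also have "\<dots> = 3 / 2 * c * ((4 * w - 1) * (\<rho> - 112 * c ^ 2 * w)) * H ^ 2"
    unfolding 8 e2 by (simp add: power2_eq_square)
  finally have L: "243 / 2 * (c * e ^ 2 * ?R) = 3 / 2 * c * ((4 * w - 1) * (\<rho> - 112 * c ^ 2 * w)) * H ^ 2" .
  show "243 / 2 * (c * e ^ 2 * ?R) / (C * H ^ 2) = 3 * c / (2 * C) * ((4 * w - 1) * (\<rho> - 112 * c ^ 2 * w))"
    unfolding L using C H(2) by simp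
qed

section \<open>The signature curves for the two groups\<close>

lemma of_nat_ge_3_nonzero:
  assumes "d \<ge> 3" "c = (of_nat d :: complex)"
  shows "c \<noteq> 0" "c \<noteq> 1" "c - 2 \<noteq> 0" "2 * c - 1 \<noteq> 0" "c + 1 \<noteq> 0"
proof -
  show "c \<noteq> 0" "c \<noteq> 1" using assms by auto
  have "c - 2 = of_nat (d - 2)" "2 * c - 1 = of_nat (2 * d - 1)" "c + 1 = of_nat (Suc d)"
    using assms by (simp_all add: of_nat_diff)
  thus "c - 2 \<noteq> 0" "2 * c - 1 \<noteq> 0" "c + 1 \<noteq> 0" using assms(1) by (auto simp del: of_nat_Suc of_nat_diff)
qed

lemma signature_curve_affine:
  fixes c :: complex
  assumes d: "d \<ge> 3" and c: "c = of_nat d"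
    and f: "f = smult ((c - 2) ^ 2 / ((2 * c - 1) * (c + 1))) ([:1, 3 * c:] ^ 2 * [:- 4, 3 * (3 - c):])"
    and g: "g = smult ((c - 2) / ((2 * c - 1) * (c + 1))) [:- 2 * (c - 2), 27 * c - 9, 9 * c * (c - 5):]"
    and V: "zero_locus G = range (\<lambda>w. (poly f w, poly g w))"
  shows "signature_curve (fermat d) affine_invariants = zero_locus G"
proof -
  note c0 = of_nat_ge_3_nonzero[OF d c]
  define m where "m = [:- (c - 2), - (c + 1), - (c + 1):]"
  have m: "poly m X = (c + 1) * (X * (- 1 - X)) - (c - 2)" for X
    by (simp add: m_def algebra_simps)
  \<comment> \<open>The values 0 and -1 of \<open>X\<close> belong to \<open>x = 0\<close> and
    \<open>y = 0\<close>; the zeros of \<open>m\<close> are the poles of the parameter.\<close>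
  define Z where "Z = {0, - 1} \<union> {X. poly m X = 0}"
  show ?thesis unfolding affine_invariants_def
  proof (rule signature_curve_fermat[where Z = Z and m = m and n = 1, OF _ V])
    show "d > 0" using d by simp
    have "m \<noteq> 0" using c0 by (simp add: m_def)
    thus "finite Z" by (simp add: Z_def poly_roots_finite)
    show "poly m X \<noteq> 0" if "X \<notin> Z" for X using that by (simp add: Z_def)
    show "1 - smult w m \<noteq> 0" for w
    proof
      assume "1 - smult w m = 0"
      \<comment> \<open>\<open>m\<close> is \<open>- (c - 2)\<close> at 0 and \<open>- 3 * c\<close>
        at 1; equal values would force \<open>c = - 1\<close>.\<close>
      hence "poly (1 - smult w m) 0 = 0" "poly (1 - smult w m) 1 = 0" by simp_all
      hence 1: "1 + w * (c - 2) = 0" "1 + 3 * w * c = 0" by (simp_all add: m algebra_simps)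
      hence "2 * w * (c + 1) = 0" by algebra
      thus False using 1 c0 by simp
    qed
    fix q assume q: "q \<in> zero_locus (fermat d)" "fst q ^ d \<notin> Z"
    obtain x y where xy: "q = (x, y)" by (cases q)
    define X where "X = x ^ d"
    define e where "e = X * (- 1 - X)"
    define D where "D = 2 * X + 1"
    define C where "C = (2 * c - 1) * (c - 2) * (c + 1)"
    define b where "b = poly m X"
    have X: "X \<noteq> 0" "X \<noteq> - 1" and b0: "b \<noteq> 0" using q(2) by (auto simp: Z_def xy X_def b_def)
    have b: "b = (c + 1) * e - (c - 2)" by (simp add: b_def m e_def)
    have p: "(x, y) \<in> zero_locus (fermat d)" using q xy by simp
    have y0: "y \<noteq> 0" using p X d by (auto simp: in_fermat_iff X_def zero_power eq_neg_iff_add_eq_0 algebra_simps)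
    let ?u = "curve_jet (fermat d) (x, y)"
    obtain s t where st: "s \<noteq> 0" "t \<noteq> 0"
      and T4: "\<Theta>4 (?u) = s ^ 2 * t ^ 6 * (9 * ((2 * c - 1) * b))"
      and T5: "\<Theta>5 (?u) = s ^ 3 * t ^ 9 * (- 27 * (C * (e + 2) * D))"
      and T6: "\<Theta>6 (?u) = s ^ 4 * t ^ 12 * (81 * (C * ((4 - 2 * c) * e ^ 2 + (7 + 4 * c) * e - (2 + 2 * c))))"
      unfolding b by (rule Theta_fermat[OF p d X_def X c e_def D_def C_def]) blast
    have D2: "D ^ 2 = 1 - 4 * e" unfolding D_def e_def by algebra
    have "eval2 (pderiv (fermat d)) q \<noteq> 0" using y0 d by (simp add: xy eval2_pderiv_fermat)
    moreover have "\<Theta>4 (?u) \<noteq> 0" unfolding T4 using st c0 b0 by simp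
    moreover have "\<Theta>5 (?u) ^ 2 / \<Theta>4 (?u) ^ 3 = poly f (1 / b)"
    proof -
      have "\<Theta>5 (?u) ^ 2 = s ^ 6 * t ^ 18 * 729 * (C ^ 2 * (e + 2) ^ 2 * (1 - 4 * e))"
        unfolding T5 D2[symmetric] by (simp; algebra)
      moreover have "\<Theta>4 (?u) ^ 3 = s ^ 6 * t ^ 18 * 729 * ((2 * c - 1) * b) ^ 3"
        unfolding T4 by (simp add: power_mult_distrib flip: power_mult)
      ultimately have "\<Theta>5 (?u) ^ 2 / \<Theta>4 (?u) ^ 3
          = C ^ 2 * (e + 2) ^ 2 * (1 - 4 * e) / ((2 * c - 1) * b) ^ 3"
        using st by simp
      also note affine_invariants_fermat_param(1)[OF b b0 c0(4,5) C_def]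
      also have "(c - 2) ^ 2 / ((2 * c - 1) * (c + 1)) * ((1 + 3 * c * (1 / b)) ^ 2 * (3 * (3 - c) * (1 / b) - 4)) = poly f (1 / b)"
        by (simp add: f algebra_simps)
      finally show ?thesis .
    qed
    moreover have "\<Theta>6 (?u) / \<Theta>4 (?u) ^ 2 = poly g (1 / b)"
    proof -
      have "\<Theta>4 (?u) ^ 2 = s ^ 4 * t ^ 12 * 81 * ((2 * c - 1) * b) ^ 2"
        unfolding T4 by (simp add: power_mult_distrib flip: power_mult)
      hence "\<Theta>6 (?u) / \<Theta>4 (?u) ^ 2
          = C * ((4 - 2 * c) * e ^ 2 + (7 + 4 * c) * e - (2 + 2 * c)) / ((2 * c - 1) * b) ^ 2"
        using st by (simp add: T6)
      also note affine_invariants_fermat_param(2)[OF b b0 c0(4,5) C_def]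
      also have "(c - 2) / ((2 * c - 1) * (c + 1))
        * (9 * c * (c - 5) * (1 / b) ^ 2 + (27 * c - 9) * (1 / b) - 2 * (c - 2)) = poly g (1 / b)"
        unfolding g poly_smult poly_pCons poly_0 by algebra
      finally show ?thesis .
    qed
    ultimately show "eval2 (pderiv (fermat d)) q \<noteq> 0
      \<and> \<Theta>4 (curve_jet (fermat d) q) ^ 3 \<noteq> 0 \<and> \<Theta>4 (curve_jet (fermat d) q) ^ 2 \<noteq> 0
      \<and> \<Theta>5 (curve_jet (fermat d) q) ^ 2 / \<Theta>4 (curve_jet (fermat d) q) ^ 3 = poly f (poly 1 (fst q ^ d) / poly m (fst q ^ d))
      \<and> \<Theta>6 (curve_jet (fermat d) q) / \<Theta>4 (curve_jet (fermat d) q) ^ 2 = poly g (poly 1 (fst q ^ d) / poly m (fst q ^ d))"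
      by (simp add: xy b_def X_def)
  qed
qed

lemma signature_curve_projective:
  fixes c :: complex
  assumes d: "d \<ge> 3" and c: "c = of_nat d"
    and C: "C = (2 * c - 1) * (c - 2) * (c + 1)" and \<rho>: "\<rho> = 3 - 3 * c + 10 * c ^ 2"
    and f: "f = smult (27 / (8 * C ^ 2)) ([:0, 1:] * [:\<rho>, - 28 * c ^ 2:] ^ 3)"
    and g: "g = smult (3 * c / (2 * C)) ([:- 1, 4:] * [:\<rho>, - 112 * c ^ 2:])"
    and V: "zero_locus G = range (\<lambda>w. (poly f w, poly g w))"
  shows "signature_curve (fermat d) projective_invariants = zero_locus G"
proof -
  note c0 = of_nat_ge_3_nonzero[OF d c]
  have C0: "C \<noteq> 0" using c0 by (simp add: C)
  define n :: "complex poly" where "n = [:1, 1, 1:] ^ 3"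
  define m :: "complex poly" where "m = [:1, 4, 4:] * [:2, - 1, - 1:] ^ 2"
  have n: "poly n X = (1 - X * (- 1 - X)) ^ 3" for X
    by (simp add: n_def algebra_simps)
  have m: "poly m X = (1 - 4 * (X * (- 1 - X))) * (X * (- 1 - X) + 2) ^ 2" for X
    by (simp add: m_def algebra_simps)
  define Z where "Z = {0, - 1} \<union> {X. poly m X = 0}"
  show ?thesis unfolding projective_invariants_def
  proof (rule signature_curve_fermat[where Z = Z and m = m and n = n, OF _ V])
    show "d > 0" using d by simp
    have "poly m 0 \<noteq> 0" by (simp add: m)
    hence "m \<noteq> 0" by auto
    thus "finite Z" by (simp add: Z_def poly_roots_finite)
    show "poly m X \<noteq> 0" if "X \<notin> Z" for X using that by (simp add: Z_def)
    show "n - smult w m \<noteq> 0" for w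
    proof
      assume "n - smult w m = 0"
      \<comment> \<open>At 1 the factor \<open>e + 2\<close> of \<open>m\<close> vanishes, while
        \<open>n\<close> does not.\<close>
      hence "poly (n - smult w m) 1 = 0" by simp
      thus False by (simp add: n m)
    qed
    fix q assume q: "q \<in> zero_locus (fermat d)" "fst q ^ d \<notin> Z"
    obtain x y where xy: "q = (x, y)" by (cases q)
    define X where "X = x ^ d"
    define e where "e = X * (- 1 - X)"
    define D where "D = 2 * X + 1"
    define H where "H = poly m X"
    define w where "w = poly n X / poly m X"
    have X: "X \<noteq> 0" "X \<noteq> - 1" and H0: "H \<noteq> 0" using q(2) by (auto simp: Z_def xy X_def H_def)
    have H: "H = (1 - 4 * e) * (e + 2) ^ 2" by (simp add: H_def m e_def)
    have w: "w = (1 - e) ^ 3 / H" by (simp add: w_def n H_def e_def)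
    have p: "(x, y) \<in> zero_locus (fermat d)" using q xy by simp
    have y0: "y \<noteq> 0" using p X d by (auto simp: in_fermat_iff X_def zero_power eq_neg_iff_add_eq_0 algebra_simps)
    let ?u = "curve_jet (fermat d) (x, y)"
    let ?P = "(4 - 4 * c + 4 * c ^ 2) * (1 - e) ^ 3 - (27 - 27 * c + 90 * c ^ 2) * e ^ 2"
    let ?R = "(4 - 4 * c - 24 * c ^ 2) * (1 - e) ^ 3 - (27 - 27 * c + 90 * c ^ 2) * e ^ 2"
    obtain s t where st: "s \<noteq> 0" "t \<noteq> 0"
      and T5: "\<Theta>5 ?u = s ^ 3 * t ^ 9 * (- 27 * (C * (e + 2) * D))"
      and T7: "2 * \<Theta>7 ?u = s ^ 8 * t ^ 24 * (3 ^ 8 * (9 * C ^ 2 * (1 - e) * ?P))"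
      and T8: "2 * \<Theta>8 ?u = s ^ 12 * t ^ 36 * (3 ^ 12 * (243 * c * C ^ 3 * e ^ 2 * ?R))"
      by (rule Theta_fermat[OF p d X_def X c e_def D_def C]) blast
    \<comment> \<open>The common factor of \<open>\<Theta>5 ^ 4\<close> and
      \<open>\<Theta>8\<close>; its square is common to \<open>\<Theta>5 ^ 8\<close> and
      \<open>\<Theta>7 ^ 3\<close>.\<close>
    define k where "k = s ^ 12 * t ^ 36 * 3 ^ 12 * C ^ 3"
    have k0: "k \<noteq> 0" using st C0 by (simp add: k_def)
    have "D ^ 2 = 1 - 4 * e" unfolding D_def e_def by algebra
    hence HD: "H = ((e + 2) * D) ^ 2" unfolding H by (simp add: power_mult_distrib)
    have T54: "\<Theta>5 ?u ^ 4 = k * (C * H ^ 2)"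
      unfolding T5 HD k_def by (simp; algebra)
    have "\<Theta>5 ?u ^ 8 = (\<Theta>5 ?u ^ 4) ^ 2" by (simp flip: power_mult)
    hence T58: "\<Theta>5 ?u ^ 8 = k ^ 2 * (C ^ 2 * H ^ 4)" by (simp add: T54 power_mult_distrib flip: power_mult)
    have "8 * \<Theta>7 ?u ^ 3 = (2 * \<Theta>7 ?u) ^ 3" by simp
    also have "\<dots> = 729 * k ^ 2 * ((1 - e) * ?P) ^ 3"
      unfolding T7 k_def by (simp add: power_mult_distrib flip: power_mult)
    finally have "\<Theta>7 ?u ^ 3 = 729 * k ^ 2 * ((1 - e) * ?P) ^ 3 / 8"
      by (metis nonzero_mult_div_cancel_left zero_neq_numeral)
    hence T73: "\<Theta>7 ?u ^ 3 = k ^ 2 * (729 / 8 * ((1 - e) * ?P) ^ 3)" by simp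
    have T8': "\<Theta>8 ?u = k * (243 / 2 * (c * e ^ 2 * ?R))"
      using T8 unfolding k_def by (simp add: field_simps)
    have "eval2 (pderiv (fermat d)) q \<noteq> 0" using y0 d by (simp add: xy eval2_pderiv_fermat)
    moreover have "\<Theta>5 ?u \<noteq> 0" unfolding T5 using st C0 H0 HD by simp
    moreover have "\<Theta>7 ?u ^ 3 / \<Theta>5 ?u ^ 8 = poly f w"
    proof -
      have "\<Theta>7 ?u ^ 3 / \<Theta>5 ?u ^ 8 = 729 / 8 * ((1 - e) * ?P) ^ 3 / (C ^ 2 * H ^ 4)"
        unfolding T73 T58 using k0 by simp
      also note projective_invariants_fermat_param(1)[OF H H0 C0 w \<rho>]
      also have "27 / (8 * C ^ 2) * (w * (\<rho> - 28 * c ^ 2 * w) ^ 3) = poly f w"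
        by (simp add: f algebra_simps)
      finally show ?thesis .
    qed
    moreover have "\<Theta>8 ?u / \<Theta>5 ?u ^ 4 = poly g w"
    proof -
      have "\<Theta>8 ?u / \<Theta>5 ?u ^ 4 = 243 / 2 * (c * e ^ 2 * ?R) / (C * H ^ 2)"
        unfolding T8' T54 using k0 by simp
      also note projective_invariants_fermat_param(2)[OF H H0 C0 w \<rho>]
      also have "3 * c / (2 * C) * ((4 * w - 1) * (\<rho> - 112 * c ^ 2 * w)) = poly g w"
        by (simp add: g algebra_simps)
      finally show ?thesis .
    qed
    ultimately show "eval2 (pderiv (fermat d)) q \<noteq> 0
      \<and> \<Theta>5 (curve_jet (fermat d) q) ^ 8 \<noteq> 0 \<and> \<Theta>5 (curve_jet (fermat d) q) ^ 4 \<noteq> 0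
      \<and> \<Theta>7 (curve_jet (fermat d) q) ^ 3 / \<Theta>5 (curve_jet (fermat d) q) ^ 8 = poly f (poly n (fst q ^ d) / poly m (fst q ^ d))
      \<and> \<Theta>8 (curve_jet (fermat d) q) / \<Theta>5 (curve_jet (fermat d) q) ^ 4 = poly g (poly n (fst q ^ d) / poly m (fst q ^ d))"
      by (simp add: xy w_def X_def)
  qed
qed


section \<open>Degrees of the signature curves\<close>

lemma degree_signature_curve_affine:
  fixes c :: complex
  assumes d: "d \<ge> 3" and c: "c = of_nat d"
  shows "irreducible_curve_of_degree (signature_curve (fermat d) affine_invariants) (if d = 3 then 2 else 3)"
proof -
  note c0 = of_nat_ge_3_nonzero[OF d c]
  define \<kappa> where "\<kappa> = (c - 2) ^ 2 / ((2 * c - 1) * (c + 1))"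
  define \<mu> where "\<mu> = (c - 2) / ((2 * c - 1) * (c + 1))"
  define f where "f = smult \<kappa> ([:1, 3 * c:] ^ 2 * [:- 4, 3 * (3 - c):])"
  define g where "g = smult \<mu> [:- 2 * (c - 2), 27 * c - 9, 9 * c * (c - 5):]"
  have nz: "\<kappa> \<noteq> 0" "\<mu> \<noteq> 0" using c0 by (auto simp: \<kappa>_def \<mu>_def)
  have pf: "poly f w = \<kappa> * ((1 + 3 * c * w) ^ 2 * (3 * (3 - c) * w - 4))" for w
    by (simp add: f_def algebra_simps)
  have pg: "poly g w = \<mu> * (9 * c * (c - 5) * w ^ 2 + (27 * c - 9) * w - 2 * (c - 2))" for w
    by (simp add: g_def algebra_simps power2_eq_square)
  have c3: "c = 3 \<longleftrightarrow> d = 3" and c5: "c = 5 \<longleftrightarrow> d = 5"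
    using of_nat_eq_iff[of d 3, where ?'a = complex] of_nat_eq_iff[of d 5, where ?'a = complex] by (simp_all add: c)
  have "\<exists>G. irreducible G \<and> zero_locus G = range (\<lambda>w. (poly f w, poly g w))
      \<and> total_degree G = (if d = 3 then 2 else 3)"
  proof (cases "d = 5")
    case True
    \<comment> \<open>Here the quadratic coefficient of \<open>g\<close> vanishes.\<close>
    hence "c = 5" using c5 by simp
    have "degree f = 3"
      using nz by (simp add: f_def \<open>c = 5\<close> power2_eq_square)
    moreover have "poly g w = - 6 * \<mu> + 126 * \<mu> * w" for w by (simp add: pg \<open>c = 5\<close> algebra_simps)
    ultimately show ?thesis using irreducible_graph_curve[of g "- 6 * \<mu>" "126 * \<mu>" f] nz True by auto
  next
    case False
    \<comment> \<open>The vertex of the parabola \<open>g\<close>; \<open>\<alpha>\<close> and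
      \<open>\<beta>\<close> below are the values there of the linear factors of
      \<open>f\<close>.\<close>
    define w0 where "w0 = - (3 * c - 1) / (2 * c * (c - 5))"
    have c5': "c - 5 \<noteq> 0" using False c5 by simp
    define \<alpha> where "\<alpha> = 1 + 3 * c * w0"
    define \<beta> where "\<beta> = 3 * (3 - c) * w0 - 4"
    have w0: "2 * c * (c - 5) * w0 = - (3 * c - 1)" using c0 c5' by (simp add: w0_def)
    have g: "poly g w = \<mu> * (- 9 * c * (c - 5) * w0 ^ 2 - 2 * (c - 2)) + 9 * c * (c - 5) * \<mu> * (w - w0) ^ 2" for w
      unfolding pg using w0 by algebra
    have f: "poly f w = \<kappa> * \<alpha> ^ 2 * \<beta> + \<kappa> * (3 * (3 - c) * \<alpha> ^ 2 + 6 * c * \<alpha> * \<beta>) * (w - w0)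
        + \<kappa> * (18 * c * (3 - c) * \<alpha> + 9 * c ^ 2 * \<beta>) * (w - w0) ^ 2
        + 27 * c ^ 2 * (3 - c) * \<kappa> * (w - w0) ^ 3 + 0 * (w - w0) ^ 4" for w
      unfolding pf \<alpha>_def \<beta>_def by (simp; algebra)
    \<comment> \<open>For \<open>c = 3\<close> the cubic coefficient of \<open>f\<close> vanishes,
      so the linear one must be shown nonzero at the explicit vertex.\<close>
    have w0_3: "w0 = 2 / 3" if "c = 3" using w0 that by (simp add: field_simps)
    show ?thesis
    proof (rule irreducible_quadratic_curve[OF f g])
      show "9 * c * (c - 5) * \<mu> \<noteq> 0" using c0 c5' nz by simp
      show "\<kappa> * (3 * (3 - c) * \<alpha> ^ 2 + 6 * c * \<alpha> * \<beta>) \<noteq> 0 \<or> 27 * c ^ 2 * (3 - c) * \<kappa> \<noteq> 0"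
      proof (cases "c = 3")
        case True
        show ?thesis unfolding \<alpha>_def \<beta>_def w0_3[OF True] using True nz by simp
      qed (use nz c0 in auto)
    qed (use nz c0 c3 in auto)
  qed
  then obtain G where G: "irreducible G" "zero_locus G = range (\<lambda>w. (poly f w, poly g w))"
      "total_degree G = (if d = 3 then 2 else 3)" by blast
  have "signature_curve (fermat d) affine_invariants = zero_locus G"
    by (rule signature_curve_affine[OF d c f_def[unfolded \<kappa>_def] g_def[unfolded \<mu>_def] G(2)])
  thus ?thesis using G unfolding irreducible_curve_of_degree_def by blast
qed

lemma degree_signature_curve_projective:
  fixes c :: complex
  assumes d: "d \<ge> 3" and c: "c = of_nat d"
  shows "irreducible_curve_of_degree (signature_curve (fermat d) projective_invariants) 4"
proof -
  note c0 = of_nat_ge_3_nonzero[OF d c]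
  define C where "C = (2 * c - 1) * (c - 2) * (c + 1)"
  define \<rho> where "\<rho> = 3 - 3 * c + 10 * c ^ 2"
  define \<kappa> where "\<kappa> = 27 / (8 * C ^ 2)"
  define \<mu> where "\<mu> = 3 * c / (2 * C)"
  define f where "f = smult \<kappa> ([:0, 1:] * [:\<rho>, - 28 * c ^ 2:] ^ 3)"
  define g where "g = smult \<mu> ([:- 1, 4:] * [:\<rho>, - 112 * c ^ 2:])"
  define \<tau> where "\<tau> = 28 * c ^ 2"
  define r where "r = \<rho> / \<tau>"
  have nz: "\<kappa> \<noteq> 0" "\<mu> \<noteq> 0" "\<tau> \<noteq> 0" using c0 by (auto simp: \<kappa>_def \<mu>_def C_def \<tau>_def)
  have \<rho>: "\<rho> = \<tau> * r" using nz by (simp add: r_def)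
  have pf: "poly f w = \<kappa> * (w * (\<tau> * r - \<tau> * w) ^ 3)" for w
    by (simp add: f_def \<rho> \<tau>_def algebra_simps)
  have pg: "poly g w = \<mu> * ((4 * w - 1) * (\<tau> * r - 4 * \<tau> * w))" for w
    by (simp add: g_def \<rho> \<tau>_def algebra_simps)
  \<comment> \<open>The midpoint of the zeros \<open>1 / 4\<close> and \<open>r / 4\<close> of
    \<open>g\<close>. With \<open>s\<close> and \<open>\<nu>\<close> below, \<open>f\<close> is
    \<open>\<nu> * (t + a) * (t - s) ^ 3\<close> in \<open>t = w - a\<close>.\<close>
  define a where "a = (1 + r) / 8"
  define s where "s = r - a"
  have a: "8 * a = 1 + r" by (simp add: a_def)
  have g: "poly g w = \<mu> * \<tau> * (1 - r) ^ 2 / 4 + (- 16 * \<mu> * \<tau>) * (w - a) ^ 2" for w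
    unfolding pg a_def by (simp add: field_simps power2_eq_square)
  define \<nu> where "\<nu> = - \<kappa> * \<tau> ^ 3"
  have \<nu>: "\<nu> \<noteq> 0" using nz by (simp add: \<nu>_def)
  have f: "poly f w = \<nu> * (- a * s ^ 3) + \<nu> * (s ^ 2 * (3 * a - s)) * (w - a)
      + \<nu> * (3 * s ^ 2 - 3 * a * s) * (w - a) ^ 2 + \<nu> * (a - 3 * s) * (w - a) ^ 3 + \<nu> * (w - a) ^ 4" for w
    unfolding pf \<nu>_def s_def by algebra
  \<comment> \<open>If both odd coefficients vanish, then \<open>a = s = 0\<close>, hence
    \<open>r = 0\<close>, against \<open>8 * a = 1 + r\<close>.\<close>
  have odd: "s ^ 2 * (3 * a - s) \<noteq> 0 \<or> a - 3 * s \<noteq> 0"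
  proof (rule ccontr)
    assume "\<not> ?thesis"
    hence "s ^ 2 * (3 * a - s) = 0" "a = 3 * s" by auto
    hence "s = 0" "a = 0" by auto
    thus False using a by (simp add: s_def)
  qed
  obtain G where G: "irreducible G" "zero_locus G = range (\<lambda>w. (poly f w, poly g w))" "total_degree G = 4"
    using irreducible_quadratic_curve[OF f g, of 4] nz \<nu> odd by auto
  have "signature_curve (fermat d) projective_invariants = zero_locus G"
    by (rule signature_curve_projective[OF d c C_def \<rho>_def f_def[unfolded \<kappa>_def] g_def[unfolded \<mu>_def] G(2)])
  thus ?thesis using G unfolding irreducible_curve_of_degree_def by blast
qed

theorem theorem4p15:
  fixes d :: nat
  assumes "d \<ge> 3"
  shows "irreducible_curve_of_degree (signature_curve (fermat d) projective_invariants) 4 \<and>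
    (d = 3 \<longrightarrow> irreducible_curve_of_degree (signature_curve (fermat d) affine_invariants) 2) \<and>
    (d \<ge> 4 \<longrightarrow> irreducible_curve_of_degree (signature_curve (fermat d) affine_invariants) 3)"
  using degree_signature_curve_projective[OF assms refl] degree_signature_curve_affine[OF assms refl]
  by auto

end
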